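(* Let $X\in\mathfrak{gl}(n,\mathbb{Q})$ be a semisimple matrix with square-free characteristic polynomial, and let $\alpha_1,\ldots,\alpha_n$ be its eigenvalues in a splitting field. Let $t+1$ be the degree of the minimal polynomial of $X$. Let $\underline{e}^1,\ldots,\underline{e}^l$ be a $\mathbb{Z}$-basis of $$\Lambda=\Big\{(e_1,\ldots,e_n)\in\mathbb{Z}^n\ \Big|\ \sum_{k=1}^n e_k\alpha_k=0\Big\}.$$ For $\underline{e}=(e_1,\ldots,e_n)\in\mathbb{Z}^n$ and $i\ge 0$ put $\Delta_i(\underline{e})=\sum_{k=1}^n e_k\alpha_k^i$, and let $$M(\underline{e})=\Big\{(u_0,\ldots,u_t)\in\mathbb{Q}^{t+1}\ \Big|\ \sum_{i=0}^t u_i\Delta_i(\underline{e})=0\Big\}$$ be the space of rational linear dependencies of $\Delta_0(\underline{e}),\ldots,\Delta_t(\underline{e})$. Let $\Upsilon=\bigcap_{j=1}^l M(\underline{e}^j)$ (with $\Upsilon=\mathbb{Q}^{t+1}$ if $l=0$). Then, as $(u_0,\ldots,u_t)$ runs through a $\mathbb{Q}$-basis of $\Upsilon$, the matrices $\sum_{i=0}^t u_iX^i$ form a $\mathbb{Q}$-basis of the algebraic hull $\mathfrak{g}_{\mathbb{Q}}(X)$ of the Lie algebra spanned by $X$.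
   Context: For a field $F$ of characteristic $0$, a subgroup $G\subset \mathrm{GL}(n,F)$ is called algebraic if it is the set of all $g\in \mathrm{GL}(n,F)$ at which a given set of polynomial functions on the $n\times n$-matrices vanishes; to it corresponds its Lie algebra $\mathrm{Lie}(G)\subset\mathfrak{gl}(n,F)$. A Lie subalgebra of $\mathfrak{gl}(n,F)$ is called algebraic if it equals $\mathrm{Lie}(G)$ for some algebraic subgroup $G$. By a theorem of Chevalley, every Lie subalgebra of $\mathfrak{gl}(n,F)$ is contained in a unique smallest algebraic Lie algebra, called its algebraic hull. For $X\in\mathfrak{gl}(n,F)$, $\mathfrak{g}_F(X)$ denotes the algebraic hull of the Lie algebra spanned by $X$. The convention $\alpha^0=1$ is used also for $\alpha=0$. *)

theory Defs
  imports
    "HOL-Analysis.Analysis"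
    "HOL-Computational_Algebra.Polynomial"
    "HOL-Computational_Algebra.Squarefree"
    "HOL-Library.Function_Algebras"
    "HOL-Library.Poly_Mapping"
begin

section \<open>Linear algebra\<close>

text \<open>
  The type of square matrices over \<open>'a\<close> is \<open>'a^'n^'n\<close>. Its class instances multiply
  (and take powers) entrywise, and scale only over the reals; the operations below are the
  ones of linear algebra.
\<close>

definition matrix_scale :: "'a::times \<Rightarrow> 'a^'n^'m \<Rightarrow> 'a^'n^'m" where
  "matrix_scale c A = (\<chi> i j. c * A $ i $ j)"

interpretation matrix_space: vector_space "matrix_scale :: 'a::field \<Rightarrow> 'a^'n^'m \<Rightarrow> 'a^'n^'m"
  by unfold_locales (simp_all add: matrix_scale_def vec_eq_iff algebra_simps)

definition matrix_pow :: "'a::semiring_1^'n^'n \<Rightarrow> nat \<Rightarrow> 'a^'n^'n" where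
  "matrix_pow A i = ((**) A ^^ i) (mat 1)"

definition seq_scale :: "'a::times \<Rightarrow> (nat \<Rightarrow> 'a) \<Rightarrow> (nat \<Rightarrow> 'a)" where
  "seq_scale c u = (\<lambda>i. c * u i)"

interpretation seq_space: vector_space "seq_scale :: 'a::field \<Rightarrow> (nat \<Rightarrow> 'a) \<Rightarrow> (nat \<Rightarrow> 'a)"
  by unfold_locales (simp_all add: seq_scale_def fun_eq_iff algebra_simps)

lemma module_vec_scale: "module ((*s) :: 'a::comm_ring_1 \<Rightarrow> 'a^'n \<Rightarrow> 'a^'n)"
  by unfold_locales (simp_all add: vec_eq_iff algebra_simps)

text \<open>The family \<open>(b i)\<close>, \<open>i \<in> I\<close>, is a basis of the submodule \<open>V\<close>.\<close>

definition basis_family ::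
  "('a::comm_ring_1 \<Rightarrow> 'b::ab_group_add \<Rightarrow> 'b) \<Rightarrow> 'i set \<Rightarrow> ('i \<Rightarrow> 'b) \<Rightarrow> 'b set \<Rightarrow> bool" where
  "basis_family smul I b V \<longleftrightarrow>
     inj_on b I \<and> \<not> module.dependent smul (b ` I) \<and> module.span smul (b ` I) = V"

definition matrix_charpoly :: "'a::comm_ring_1^'n^'n \<Rightarrow> 'a poly" where
  "matrix_charpoly A = det (mat [:0, 1:] - (\<chi> i j. [:A $ i $ j:]))"

definition matrix_poly :: "'a::comm_ring_1 poly \<Rightarrow> 'a^'n^'n \<Rightarrow> 'a^'n^'n" where
  "matrix_poly p A = (\<Sum>i\<le>degree p. matrix_scale (coeff p i) (matrix_pow A i))"

definition matrix_minpoly :: "'a::field^'n^'n \<Rightarrow> 'a poly" where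
  "matrix_minpoly A =
     (THE p. lead_coeff p = 1 \<and> matrix_poly p A = 0 \<and>
             (\<forall>q. matrix_poly q A = 0 \<longrightarrow> p dvd q))"

text \<open>
  Semisimplicity: every invariant subspace has an invariant complement. (Over a perfect field
  this is the same as being diagonalisable over an algebraic closure.)
\<close>

definition invariant_subspace :: "'a::field^'n^'n \<Rightarrow> ('a^'n) set \<Rightarrow> bool" where
  "invariant_subspace A W \<longleftrightarrow> vec.subspace W \<and> (\<forall>w\<in>W. A *v w \<in> W)"

definition semisimple_matrix :: "'a::field^'n^'n \<Rightarrow> bool" where
  "semisimple_matrix A \<longleftrightarrow>
     (\<forall>W. invariant_subspace A W \<longrightarrow>
       (\<exists>W'. invariant_subspace A W' \<and> W \<inter> W' = {0} \<and>
             (\<forall>v. \<exists>w\<in>W. \<exists>w'\<in>W'. v = w + w')))"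


section \<open>Algebraic groups and algebraic Lie algebras\<close>

text \<open>
  Polynomials over \<open>'a\<close> in the matrix coordinates \<open>x(i,j)\<close>: a monomial is its finitely
  supported exponent function, a polynomial its finitely supported coefficient function.
\<close>

type_synonym ('a, 'n) coord_poly = "(('n \<times> 'n) \<Rightarrow>\<^sub>0 nat) \<Rightarrow>\<^sub>0 'a"

definition coord_eval :: "('a::comm_ring_1, 'n::finite) coord_poly \<Rightarrow> 'a^'n^'n \<Rightarrow> 'a" where
  "coord_eval p g =
     (\<Sum>m\<in>Poly_Mapping.keys p.
        Poly_Mapping.lookup p m * (\<Prod>(i,j)\<in>UNIV. (g $ i $ j) ^ Poly_Mapping.lookup m (i,j)))"

text \<open>
  The formal partial derivative with respect to \<open>x v\<close>. The truncated subtraction of exponents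
  is harmless: where it truncates, the coefficient is \<open>0\<close>.
\<close>

definition coord_deriv ::
  "'n \<times> 'n \<Rightarrow> ('a::comm_ring_1, 'n::finite) coord_poly \<Rightarrow> ('a, 'n) coord_poly" where
  "coord_deriv v p =
     (\<Sum>m\<in>Poly_Mapping.keys p.
        Poly_Mapping.single (m - Poly_Mapping.single v 1)
          (of_nat (Poly_Mapping.lookup m v) * Poly_Mapping.lookup p m))"

definition algebraic_subgroup :: "('a::field_char_0^'n^'n) set \<Rightarrow> bool" where
  "algebraic_subgroup G \<longleftrightarrow>
     mat 1 \<in> G \<and> (\<forall>g\<in>G. \<forall>h\<in>G. g ** h \<in> G) \<and> (\<forall>g\<in>G. matrix_inv g \<in> G) \<and>
     (\<exists>P :: ('a, 'n) coord_poly set. G = {g. invertible g \<and> (\<forall>p\<in>P. coord_eval p g = 0)})"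

text \<open>
  The Lie algebra of \<open>G\<close> is its tangent space at the identity: the matrices along which the
  differential at \<open>1\<close> of every polynomial vanishing on \<open>G\<close> is zero.
\<close>

definition Lie_of :: "('a::field_char_0^'n^'n) set \<Rightarrow> ('a^'n^'n) set" where
  "Lie_of G =
     {A. \<forall>p :: ('a, 'n) coord_poly. (\<forall>g\<in>G. coord_eval p g = 0) \<longrightarrow>
           (\<Sum>i\<in>UNIV. \<Sum>j\<in>UNIV. A $ i $ j * coord_eval (coord_deriv (i,j) p) (mat 1)) = 0}"

definition lie_subalgebra :: "('a::field^'n^'n) set \<Rightarrow> bool" where
  "lie_subalgebra L \<longleftrightarrow>
     matrix_space.subspace L \<and> (\<forall>A\<in>L. \<forall>B\<in>L. A ** B - B ** A \<in> L)"

definition algebraic_lie_algebra :: "('a::field_char_0^'n^'n) set \<Rightarrow> bool" where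
  "algebraic_lie_algebra L \<longleftrightarrow>
     lie_subalgebra L \<and> (\<exists>G. algebraic_subgroup G \<and> L = Lie_of G)"

text \<open>
  \<open>LEAST\<close> refers to inclusion; that a least element exists is Chevalley's theorem. (The
  operator is a definite description, so a claim identifying the hull of a given Lie algebra
  involves the existence of the least element for that algebra.)
\<close>

definition algebraic_hull :: "('a::field_char_0^'n^'n) set \<Rightarrow> ('a^'n^'n) set" where
  "algebraic_hull L = (LEAST H. algebraic_lie_algebra H \<and> L \<subseteq> H)"

text \<open>A single matrix commutes with itself, so the Lie algebra it spans is its linear span.\<close>

definition algebraic_hull_of_matrix :: "'a::field_char_0^'n^'n \<Rightarrow> ('a^'n^'n) set" where
  "algebraic_hull_of_matrix X = algebraic_hull (matrix_space.span {X})"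


section \<open>Linear relations between the eigenvalues\<close>

definition eigenvalue_relations :: "'k::field_char_0^'n \<Rightarrow> (int^'n) set" where
  "eigenvalue_relations \<alpha> = {e. (\<Sum>k\<in>UNIV. of_int (e $ k) * \<alpha> $ k) = 0}"

definition Delta :: "'k::field_char_0^'n \<Rightarrow> nat \<Rightarrow> int^'n \<Rightarrow> 'k" where
  "Delta \<alpha> i e = (\<Sum>k\<in>UNIV. of_int (e $ k) * (\<alpha> $ k) ^ i)"

text \<open>
  Vectors \<open>(u\<^sub>0, \<dots>, u\<^sub>t)\<close> are represented by the sequences that vanish beyond \<open>t\<close>.
\<close>

definition rat_tuples :: "nat \<Rightarrow> (nat \<Rightarrow> rat) set" where
  "rat_tuples t = {u. \<forall>i>t. u i = 0}"

definition Delta_dependencies :: "'k::field_char_0^'n \<Rightarrow> nat \<Rightarrow> int^'n \<Rightarrow> (nat \<Rightarrow> rat) set" where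
  "Delta_dependencies \<alpha> t e = {u \<in> rat_tuples t. (\<Sum>i\<le>t. of_rat (u i) * Delta \<alpha> i e) = 0}"

text \<open>The first factor only matters for \<open>l = 0\<close>.\<close>

definition Upsilon :: "'k::field_char_0^'n \<Rightarrow> nat \<Rightarrow> nat \<Rightarrow> (nat \<Rightarrow> int^'n) \<Rightarrow> (nat \<Rightarrow> rat) set" where
  "Upsilon \<alpha> t l e = rat_tuples t \<inter> (\<Inter>j\<in>{1..l}. Delta_dependencies \<alpha> t (e j))"

end

(* Over the splitting field, X is diagonal with distinct entries alpha_k. Let L be the space of
   matrices q(X), q rational, whose eigenvalues satisfy all integral relations e in Lambda.

   Minimality: if X lies in Lie(G), the ideal of G is stable under the left-invariant derivation
   given by X. A polynomial F in this ideal restricts to sum_m c_m z^m on diagonal matrices z, so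
   iterating gives sum_m c_m (m.alpha)^r = 0 for all r. For q(X) in L the number m.q(alpha) depends
   only on m.alpha, hence sum_m c_m (m.q(alpha)) = 0, that is, F has derivative 0 along q(X).

   L is algebraic: it is the Lie algebra of the group T of rational matrices commuting with X whose
   eigenvalues satisfy the multiplicative relations e in Lambda. Here T must have enough rational
   points. They are lambda_j = prod_k (1 + s alpha_k)^(M_jk), s rational, where M is an integral
   symmetric matrix, invariant under the permutations of the roots that preserve Lambda, with
   rows orthogonal to Lambda. Invariance makes the point rational, orthogonality puts it in T, and the
   derivative at s = 0 shows that the points separate characters m with different m.alpha. *)

theory Submission
  imports Defs
begin

section \<open>Polynomial functions\<close>

text \<open>\<open>Lie_of\<close> sees a group only through the polynomials vanishing on its
  rational points, so the inclusion of L in the Lie algebra of T is a density statement about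
  rational points. Exponentials of X are not rational. What is available is the rational matrix 1 +
  sX, invertible for all but finitely many s. An integral matrix M of exponents is a homomorphism of
  the diagonal torus, and its invariance means that it is defined over the rationals; the points
  used are the images of 1 + sX. That no characters collapse beyond what Lambda forces comes from M
  being positive semidefinite.

  \<open>'k\<close> is any field of characteristic 0 over which the characteristic polynomial
  splits, so no Galois group is at hand. Descent to the rationals uses Q-linear functionals on
  \<open>'k\<close>: applied to coefficients they turn polynomials over \<open>'k\<close> into
  rational ones, and jointly they detect 0.

  Density and minimality end in the same linear algebra: if all power moments of weights c_i at
  nodes x_i vanish, then c is orthogonal to every function of the nodes
  (\<open>power_moments_vanish\<close>).\<close>

inductive polyfun :: "'a::comm_ring_1 set \<Rightarrow> (('v \<Rightarrow> 'a) \<Rightarrow> 'a) \<Rightarrow> bool" for C where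
  const: "c \<in> C \<Longrightarrow> polyfun C (\<lambda>x. c)"
| add: "polyfun C F \<Longrightarrow> polyfun C G \<Longrightarrow> polyfun C (\<lambda>x. F x + G x)"
| var_mult: "polyfun C F \<Longrightarrow> polyfun C (\<lambda>x. x v * F x)"

text \<open>Coefficients are tracked because rationality arguments need \<open>C = \<rat>\<close>.
  Closure under addition is not demanded: like terms are never collected, and a sum of constants is
  formed by the rule \<open>add\<close>.\<close>

definition coeff_ring :: "'a::comm_ring_1 set \<Rightarrow> bool" where
  "coeff_ring C \<longleftrightarrow> 0 \<in> C \<and> 1 \<in> C \<and> (\<forall>a\<in>C. - a \<in> C) \<and> (\<forall>a\<in>C. \<forall>b\<in>C. a * b \<in> C)"

lemma coeff_ring_UNIV [simp]: "coeff_ring UNIV"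
  by (simp add: coeff_ring_def)

lemma coeff_ring_Rats [simp]: "coeff_ring (\<rat> :: 'a::field_char_0 set)"
  by (auto simp: coeff_ring_def)

lemma polyfun_var: "coeff_ring C \<Longrightarrow> polyfun C (\<lambda>x. x v)"
  using polyfun.var_mult[OF polyfun.const[of 1 C], of v] by (simp add: coeff_ring_def)

lemma polyfun_const_mult:
  assumes "coeff_ring C" "c \<in> C" "polyfun C F"
  shows "polyfun C (\<lambda>x. c * F x)"
  using assms(3)
proof induction
  case (const d)
  then show ?case
    using assms by (auto simp: coeff_ring_def intro!: polyfun.const)
next
  case (add F G)
  from polyfun.add[OF add.IH] show ?case by (simp add: distrib_left)
next
  case (var_mult F v)
  from polyfun.var_mult[OF var_mult.IH, of v] show ?case by (simp add: mult.left_commute)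
qed

lemma polyfun_mult:
  assumes "coeff_ring C" "polyfun C F" "polyfun C G"
  shows "polyfun C (\<lambda>x. F x * G x)"
  using assms(2)
proof induction
  case (const c)
  then show ?case using polyfun_const_mult assms by blast
next
  case (add F G)
  from polyfun.add[OF add.IH] show ?case by (simp add: distrib_right)
next
  case (var_mult F v)
  from polyfun.var_mult[OF var_mult.IH, of v] show ?case by (simp add: mult.assoc)
qed

lemma polyfun_uminus:
  assumes "coeff_ring C" "polyfun C F"
  shows "polyfun C (\<lambda>x. - F x)"
proof -
  have "- 1 \<in> C" using assms(1) by (auto simp: coeff_ring_def)
  from polyfun_const_mult[OF assms(1) this assms(2)] show ?thesis by simp
qed

lemma polyfun_diff:
  assumes "coeff_ring C" "polyfun C F" "polyfun C G"
  shows "polyfun C (\<lambda>x. F x - G x)"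
  using polyfun.add[OF assms(2) polyfun_uminus[OF assms(1,3)]] by simp

lemma polyfun_sum:
  assumes "coeff_ring C" "\<And>i. i \<in> A \<Longrightarrow> polyfun C (F i)"
  shows "polyfun C (\<lambda>x. \<Sum>i\<in>A. F i x)"
  using assms(2)
proof (induction A rule: infinite_finite_induct)
  case (insert a A)
  then have "polyfun C (\<lambda>x. F a x + (\<Sum>i\<in>A. F i x))" by (intro polyfun.add) auto
  with insert show ?case by simp
qed (use assms(1) in \<open>auto simp: coeff_ring_def intro: polyfun.const\<close>)

lemma polyfun_prod:
  assumes "coeff_ring C" "\<And>i. i \<in> A \<Longrightarrow> polyfun C (F i)"
  shows "polyfun C (\<lambda>x. \<Prod>i\<in>A. F i x)"
  using assms(2)
proof (induction A rule: infinite_finite_induct)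
  case (insert a A)
  then have "polyfun C (\<lambda>x. F a x * (\<Prod>i\<in>A. F i x))" by (intro polyfun_mult assms(1)) auto
  with insert show ?case by simp
qed (use assms(1) in \<open>auto simp: coeff_ring_def intro: polyfun.const\<close>)

lemma polyfun_power:
  assumes "coeff_ring C" "polyfun C F"
  shows "polyfun C (\<lambda>x. F x ^ n)"
  using polyfun_prod[OF assms(1), of "{..<n}" "\<lambda>_. F"] assms(2) by simp

lemma polyfun_subst:
  assumes "coeff_ring C" "polyfun C F" "\<And>v. polyfun C (G v)"
  shows "polyfun C (\<lambda>x. F (\<lambda>v. G v x))"
  using assms(2)
  by induction (auto intro!: polyfun.intros polyfun_mult assms)

text \<open>Links the inductive notion with explicit sums of monomials; the exponents
  \<open>m i\<close> may repeat, which the moment arguments below tolerate.\<close>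

lemma polyfun_normal_form:
  assumes "coeff_ring C" "polyfun C (F :: ('v::finite \<Rightarrow> 'a::comm_ring_1) \<Rightarrow> 'a)"
  shows "\<exists>(N::nat) c m. (\<forall>i<N. c i \<in> C) \<and> (\<forall>x. F x = (\<Sum>i<N. c i * (\<Prod>v\<in>UNIV. x v ^ m i v)))"
  using assms(2)
proof induction
  case (const d)
  then show ?case
    by (intro exI[of _ 1] exI[of _ "\<lambda>_. d"] exI[of _ "\<lambda>_ _. 0"]) auto
next
  case (add F G)
  obtain N :: nat and c m where
    1: "\<forall>i<N. c i \<in> C" "\<forall>x. F x = (\<Sum>i<N. c i * (\<Prod>v\<in>UNIV. x v ^ m i v))"
    using add.IH(1) by blast
  obtain N' :: nat and c' m' where
    2: "\<forall>i<N'. c' i \<in> C" "\<forall>x. G x = (\<Sum>i<N'. c' i * (\<Prod>v\<in>UNIV. x v ^ m' i v))"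
    using add.IH(2) by blast
  have "F x + G x = (\<Sum>i<N+N'. (if i < N then c i else c' (i - N)) *
      (\<Prod>v\<in>UNIV. x v ^ (if i < N then m i else m' (i - N)) v))" for x
  proof -
    have *: "{..<N+N'} = {..<N} \<union> (\<lambda>i. i + N) ` {..<N'}"
    proof -
      have "x \<in> (\<lambda>i. i + N) ` {..<N'}" if "x < N + N'" "\<not> x < N" for x
        using that by (intro image_eqI[of _ _ "x - N"]) auto
      then show ?thesis by auto
    qed
    show ?thesis
      unfolding * by (subst sum.union_disjoint) (auto simp: sum.reindex 1 2)
  qed
  then show ?case
    by (intro exI[of _ "N+N'"] exI[of _ "\<lambda>i. if i < N then c i else c' (i - N)"]
          exI[of _ "\<lambda>i. if i < N then m i else m' (i - N)"]) (use 1(1) 2(1) in auto)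
next
  case (var_mult F v)
  obtain N :: nat and c m where
    1: "\<forall>i<N. c i \<in> C" "\<forall>x. F x = (\<Sum>i<N. c i * (\<Prod>v\<in>UNIV. x v ^ m i v))"
    using var_mult.IH by blast
  have "x v * F x = (\<Sum>i<N. c i * (\<Prod>w\<in>UNIV. x w ^ ((m i)(v := Suc (m i v))) w))" for x
  proof -
    have "(\<Prod>w\<in>UNIV. x w ^ ((m i)(v := Suc (m i v))) w) = x v * (\<Prod>w\<in>UNIV. x w ^ m i w)" for i
    proof -
      have "(\<Prod>w\<in>UNIV. x w ^ ((m i)(v := Suc (m i v))) w)
          = x v ^ Suc (m i v) * (\<Prod>w\<in>UNIV - {v}. x w ^ ((m i)(v := Suc (m i v))) w)"
        by (subst prod.remove[of _ v]) auto
      also have "(\<Prod>w\<in>UNIV - {v}. x w ^ ((m i)(v := Suc (m i v))) w) = (\<Prod>w\<in>UNIV - {v}. x w ^ m i w)"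
        by (intro prod.cong) auto
      also have "x v ^ Suc (m i v) * \<dots> = x v * (\<Prod>w\<in>UNIV. x w ^ m i w)"
        by (subst prod.remove[of UNIV v]) (auto simp: mult.assoc)
      finally show ?thesis .
    qed
    then show ?thesis by (simp add: 1 sum_distrib_left mult.left_commute)
  qed
  then show ?case
    by (intro exI[of _ N] exI[of _ c] exI[of _ "\<lambda>i. (m i)(v := Suc (m i v))"]) (use 1(1) in auto)
qed

section \<open>Coordinate polynomials as functions\<close>

definition mat_of :: "('n \<times> 'n \<Rightarrow> 'a) \<Rightarrow> 'a^'n^'n" where
  "mat_of x = (\<chi> i j. x (i, j))"

definition matpolyfun :: "('a::comm_ring_1^'n^'n \<Rightarrow> 'a) \<Rightarrow> bool" where
  "matpolyfun F \<longleftrightarrow> polyfun UNIV (\<lambda>x. F (mat_of x))"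

lemma matpolyfun_const: "matpolyfun (\<lambda>g. c)"
  by (simp add: matpolyfun_def polyfun.const)

lemma matpolyfun_entry: "matpolyfun (\<lambda>g. g $ i $ j)"
  by (simp add: matpolyfun_def mat_of_def polyfun_var)

lemma matpolyfun_diff: "matpolyfun F \<Longrightarrow> matpolyfun G \<Longrightarrow> matpolyfun (\<lambda>g. F g - G g)"
  by (simp add: matpolyfun_def polyfun_diff)

lemma matpolyfun_mult: "matpolyfun F \<Longrightarrow> matpolyfun G \<Longrightarrow> matpolyfun (\<lambda>g. F g * G g)"
  by (simp add: matpolyfun_def polyfun_mult)

lemma matpolyfun_sum: "(\<And>i. i \<in> A \<Longrightarrow> matpolyfun (F i)) \<Longrightarrow> matpolyfun (\<lambda>g. \<Sum>i\<in>A. F i g)"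
  by (simp add: matpolyfun_def polyfun_sum)

lemma matpolyfun_prod: "(\<And>i. i \<in> A \<Longrightarrow> matpolyfun (F i)) \<Longrightarrow> matpolyfun (\<lambda>g. \<Prod>i\<in>A. F i g)"
  by (simp add: matpolyfun_def polyfun_prod)

lemma matpolyfun_power: "matpolyfun F \<Longrightarrow> matpolyfun (\<lambda>g. F g ^ n)"
  by (simp add: matpolyfun_def polyfun_power)

lemma matpolyfun_entry_mult:
  fixes A B :: "'a::comm_ring_1^'n^'n"
  shows "matpolyfun (\<lambda>g. (A ** g ** B) $ i $ j)"
  unfolding matrix_matrix_mult_def
  by (auto intro!: matpolyfun_sum matpolyfun_mult matpolyfun_const matpolyfun_entry)

text \<open>Translation by a group element carries a tangent condition at the identity to every
  other point of the group.\<close>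

lemma matpolyfun_left_translate:
  fixes A :: "'a::comm_ring_1^'n^'n"
  assumes "matpolyfun F"
  shows "matpolyfun (\<lambda>g. F (A ** g))"
proof -
  have "polyfun UNIV (\<lambda>x. (\<lambda>y. F (mat_of y)) (\<lambda>v. (A ** mat_of x) $ fst v $ snd v))"
  proof (rule polyfun_subst[where F = "\<lambda>y. F (mat_of y)" and
        G = "\<lambda>v x. (A ** mat_of x) $ fst v $ snd v"])
    show "polyfun UNIV (\<lambda>x. (A ** mat_of x) $ fst v $ snd v)" for v
      using matpolyfun_entry_mult[of A "mat 1"] by (simp add: matpolyfun_def)
  qed (use assms in \<open>auto simp: matpolyfun_def\<close>)
  moreover have "mat_of (\<lambda>v. (A ** mat_of x) $ fst v $ snd v) = A ** mat_of x" for x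
    by (simp add: mat_of_def vec_eq_iff)
  ultimately show ?thesis by (simp add: matpolyfun_def)
qed

lemma coord_eval_superset:
  assumes "finite S" "Poly_Mapping.keys p \<subseteq> S"
  shows "coord_eval p g = (\<Sum>m\<in>S. Poly_Mapping.lookup p m * (\<Prod>v\<in>UNIV. (g $ fst v $ snd v) ^ Poly_Mapping.lookup m v))"
proof -
  have "coord_eval p g = (\<Sum>m\<in>Poly_Mapping.keys p. Poly_Mapping.lookup p m * (\<Prod>v\<in>UNIV. (g $ fst v $ snd v) ^ Poly_Mapping.lookup m v))"
    unfolding coord_eval_def by (simp add: case_prod_beta')
  also have "\<dots> = (\<Sum>m\<in>S. Poly_Mapping.lookup p m * (\<Prod>v\<in>UNIV. (g $ fst v $ snd v) ^ Poly_Mapping.lookup m v))"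
    using assms by (intro sum.mono_neutral_left) (auto simp: in_keys_iff)
  finally show ?thesis .
qed

lemma coord_eval_add: "coord_eval (p + q) g = coord_eval p g + coord_eval q g"
proof -
  let ?S = "Poly_Mapping.keys p \<union> Poly_Mapping.keys q"
  have "Poly_Mapping.keys (p + q) \<subseteq> ?S" by (rule Poly_Mapping.keys_add)
  then show ?thesis
    by (simp add: coord_eval_superset[of ?S] lookup_add distrib_right sum.distrib)
qed

lemma coord_eval_zero [simp]: "coord_eval 0 g = 0"
  by (simp add: coord_eval_def)

lemma coord_eval_sum: "coord_eval (\<Sum>i\<in>A. p i) g = (\<Sum>i\<in>A. coord_eval (p i) g)"
  by (induction A rule: infinite_finite_induct) (auto simp: coord_eval_add)

lemma coord_eval_single:
  "coord_eval (Poly_Mapping.single m c) g = c * (\<Prod>v\<in>UNIV. (g $ fst v $ snd v) ^ Poly_Mapping.lookup m v)"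
  by (simp add: coord_eval_superset[of "{m}"])

lemma matpolyfun_coord_eval: "matpolyfun (coord_eval p)"
proof -
  have "coord_eval p = (\<lambda>g. \<Sum>m\<in>Poly_Mapping.keys p. Poly_Mapping.lookup p m *
      (\<Prod>v\<in>UNIV. (g $ fst v $ snd v) ^ Poly_Mapping.lookup m v))"
    by (rule ext, rule coord_eval_superset) auto
  then show ?thesis
    by (auto intro!: matpolyfun_sum matpolyfun_mult matpolyfun_const matpolyfun_prod
        matpolyfun_power matpolyfun_entry)
qed

text \<open>With \<open>matpolyfun_coord_eval\<close> this allows formal coordinate polynomials to
  be traded for functions, where substitution is mere composition.\<close>

lemma matpolyfun_imp_coord_eval:
  assumes "matpolyfun (F :: 'a::comm_ring_1^'n^'n \<Rightarrow> 'a)"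
  shows "\<exists>p. \<forall>g. F g = coord_eval p g"
proof -
  obtain N :: nat and c m where
    F: "\<And>x. F (mat_of x) = (\<Sum>i<N. c i * (\<Prod>v\<in>UNIV. x v ^ m i v))"
    using polyfun_normal_form[of UNIV "\<lambda>x. F (mat_of x)"] assms by (auto simp: matpolyfun_def)
  have g: "mat_of (\<lambda>v. g $ fst v $ snd v) = g" for g :: "'a^'n^'n"
    by (simp add: mat_of_def vec_eq_iff)
  \<comment> \<open>There are finitely many coordinates, so every exponent function has finite
    support and \<open>Abs_poly_mapping\<close> is harmless.\<close>
  have "F g = coord_eval (\<Sum>i<N. Poly_Mapping.single (Abs_poly_mapping (m i)) (c i)) g" for g
    using F[of "\<lambda>v. g $ fst v $ snd v"] by (simp add: g coord_eval_sum coord_eval_single)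
  then show ?thesis by blast
qed

section \<open>Directional derivatives\<close>

text \<open>The field has no topology, so the derivative is the linear coefficient of the
  restriction of \<open>F\<close> to a line. In characteristic 0 the values on the line determine
  that polynomial, hence the derivative.\<close>

definition has_dir_deriv :: "('a::comm_ring_1^'n^'n \<Rightarrow> 'a) \<Rightarrow> 'a^'n^'n \<Rightarrow> 'a^'n^'n \<Rightarrow> 'a \<Rightarrow> bool" where
  "has_dir_deriv F g B d \<longleftrightarrow>
     (\<exists>h. (\<forall>s. F (g + matrix_scale s B) = poly h s) \<and> coeff h 1 = d)"

lemma has_dir_deriv_unique:
  fixes F :: "'a::field_char_0^'n^'n \<Rightarrow> 'a"
  assumes "has_dir_deriv F g B d" "has_dir_deriv F g B d'"
  shows "d = d'"
proof -
  obtain h h' where "\<forall>s. F (g + matrix_scale s B) = poly h s" "coeff h 1 = d"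
    "\<forall>s. F (g + matrix_scale s B) = poly h' s" "coeff h' 1 = d'"
    using assms by (auto simp: has_dir_deriv_def)
  then have "poly h = poly h'" by (auto simp: fun_eq_iff)
  then show ?thesis using \<open>coeff h 1 = d\<close> \<open>coeff h' 1 = d'\<close> by (simp add: poly_eq_poly_eq_iff)
qed

definition dir_deriv :: "('a::comm_ring_1, 'n::finite) coord_poly \<Rightarrow> 'a^'n^'n \<Rightarrow> 'a^'n^'n \<Rightarrow> 'a" where
  "dir_deriv p g B = (\<Sum>i\<in>UNIV. \<Sum>j\<in>UNIV. B $ i $ j * coord_eval (coord_deriv (i,j) p) g)"

lemma coeff_1_conv_pderiv: "coeff h 1 = poly (pderiv h) (0::'a::idom)"
  by (simp add: poly_0_coeff_0 coeff_pderiv)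

lemma has_dir_deriv_coord_eval:
  fixes p :: "('a::field_char_0, 'n::finite) coord_poly"
  shows "has_dir_deriv (coord_eval p) g B (dir_deriv p g B)"
proof -
  let ?K = "Poly_Mapping.keys p"
  let ?c = "Poly_Mapping.lookup p"
  let ?g = "\<lambda>v. g $ fst v $ snd v" and ?B = "\<lambda>v. B $ fst v $ snd v"
  define h where "h = (\<Sum>m\<in>?K. smult (?c m) (\<Prod>v\<in>UNIV. [:?g v, ?B v:] ^ Poly_Mapping.lookup m v))"
  have 1: "coord_eval p (g + matrix_scale s B) = poly h s" for s
    by (simp add: coord_eval_superset[of ?K] h_def poly_sum poly_prod matrix_scale_def)
  have mon: "poly (pderiv (\<Prod>v\<in>UNIV. [:?g v, ?B v:] ^ Poly_Mapping.lookup m v)) 0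
      = (\<Sum>v\<in>UNIV. ?B v * (of_nat (Poly_Mapping.lookup m v) *
          (\<Prod>w\<in>UNIV. ?g w ^ Poly_Mapping.lookup (m - Poly_Mapping.single v 1) w)))" for m
  proof -
    have "(\<Prod>w\<in>UNIV. ?g w ^ Poly_Mapping.lookup (m - Poly_Mapping.single v 1) w)
       = ?g v ^ (Poly_Mapping.lookup m v - 1) * (\<Prod>w\<in>UNIV - {v}. ?g w ^ Poly_Mapping.lookup m w)" for v
    proof -
      have "(\<Prod>w\<in>UNIV. ?g w ^ Poly_Mapping.lookup (m - Poly_Mapping.single v 1) w)
         = ?g v ^ (Poly_Mapping.lookup m v - 1) *
           (\<Prod>w\<in>UNIV - {v}. ?g w ^ Poly_Mapping.lookup (m - Poly_Mapping.single v 1) w)"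
        by (subst prod.remove[of _ v]) (auto simp: lookup_minus)
      also have "(\<Prod>w\<in>UNIV - {v}. ?g w ^ Poly_Mapping.lookup (m - Poly_Mapping.single v 1) w) =
         (\<Prod>w\<in>UNIV - {v}. ?g w ^ Poly_Mapping.lookup m w)"
        by (intro prod.cong) (auto simp: lookup_minus lookup_single)
      finally show ?thesis .
    qed
    then show ?thesis
      by (simp add: pderiv_prod pderiv_power poly_sum poly_prod pderiv_pCons ac_simps)
  qed
  have "coeff h 1 = (\<Sum>m\<in>?K. ?c m * poly (pderiv (\<Prod>v\<in>UNIV. [:?g v, ?B v:] ^ Poly_Mapping.lookup m v)) 0)"
    by (subst coeff_1_conv_pderiv[symmetric], simp add: h_def coeff_sum)
  also have "\<dots> = (\<Sum>v\<in>UNIV. ?B v * (\<Sum>m\<in>?K. of_nat (Poly_Mapping.lookup m v) * ?c m *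
          (\<Prod>w\<in>UNIV. ?g w ^ Poly_Mapping.lookup (m - Poly_Mapping.single v 1) w)))"
    unfolding mon sum_distrib_left by (subst sum.swap) (simp add: ac_simps)
  also have "\<dots> = (\<Sum>v\<in>UNIV. ?B v * coord_eval (coord_deriv v p) g)"
    by (simp add: coord_deriv_def coord_eval_sum coord_eval_single)
  also have "\<dots> = dir_deriv p g B"
    by (simp add: dir_deriv_def sum.cartesian_product case_prod_beta')
  finally have "coeff h 1 = dir_deriv p g B" .
  with 1 show ?thesis by (auto simp: has_dir_deriv_def)
qed

text \<open>The function \<open>\<lambda>g. D g (g ** X)\<close> is the left-invariant vector field
  of \<open>X\<close> applied to \<open>F\<close>. That it is again polynomial allows the derivation
  to be iterated.\<close>

lemma matpolyfun_has_dir_deriv: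
  fixes F :: "'a::field_char_0^'n^'n \<Rightarrow> 'a"
  assumes "matpolyfun F"
  shows "\<exists>D. (\<forall>g B. has_dir_deriv F g B (D g B)) \<and> matpolyfun (\<lambda>g. D g (g ** X))"
proof -
  obtain p where p: "F = coord_eval p"
    using matpolyfun_imp_coord_eval[OF assms] by (auto simp: fun_eq_iff)
  have "matpolyfun (\<lambda>g. dir_deriv p g (g ** X))"
    unfolding dir_deriv_def
    using matpolyfun_entry_mult[of "mat 1" X]
    by (auto intro!: matpolyfun_sum matpolyfun_mult matpolyfun_coord_eval)
  then show ?thesis
    using has_dir_deriv_coord_eval[of p] unfolding p by blast
qed

lemma Lie_of_iff:
  fixes G :: "('a::field_char_0^'n^'n) set"
  shows "A \<in> Lie_of G \<longleftrightarrow>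
    (\<forall>F. matpolyfun F \<and> (\<forall>g\<in>G. F g = 0) \<longrightarrow> has_dir_deriv F (mat 1) A 0)"
proof -
  have "A \<in> Lie_of G \<longleftrightarrow> (\<forall>p. (\<forall>g\<in>G. coord_eval p g = 0) \<longrightarrow> dir_deriv p (mat 1) A = 0)"
    by (simp add: Lie_of_def dir_deriv_def)
  also have "\<dots> \<longleftrightarrow> (\<forall>p. (\<forall>g\<in>G. coord_eval p g = 0) \<longrightarrow> has_dir_deriv (coord_eval p) (mat 1) A 0)"
    using has_dir_deriv_coord_eval has_dir_deriv_unique by metis
  also have "\<dots> \<longleftrightarrow> (\<forall>F. matpolyfun F \<and> (\<forall>g\<in>G. F g = 0) \<longrightarrow> has_dir_deriv F (mat 1) A 0)"
  proof (safe)
    fix F :: "'a^'n^'n \<Rightarrow> 'a"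
    assume *: "\<forall>p. (\<forall>g\<in>G. coord_eval p g = 0) \<longrightarrow> has_dir_deriv (coord_eval p) (mat 1) A 0"
      and "matpolyfun F" "\<forall>g\<in>G. F g = 0"
    moreover obtain p where "F = coord_eval p"
      using matpolyfun_imp_coord_eval[OF \<open>matpolyfun F\<close>] by (auto simp: fun_eq_iff)
    ultimately show "has_dir_deriv F (mat 1) A 0" by blast
  qed (use matpolyfun_coord_eval in blast)
  finally show ?thesis .
qed

section \<open>Interpolation and rational functionals\<close>

text \<open>Newton interpolation, one node at a time. The degree bound later keeps the powers of X
  below the size of the matrix.\<close>

lemma interpolation_exists:
  fixes A :: "'a::field set"
  assumes "finite A"
  shows "\<exists>p. (\<forall>a\<in>A. poly p a = f a) \<and> (\<forall>i\<ge>card A. coeff p i = 0)"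
  using assms
proof (induction A)
  case (insert a A)
  then obtain p where p: "\<And>b. b \<in> A \<Longrightarrow> poly p b = f b" "\<And>i. i \<ge> card A \<Longrightarrow> coeff p i = 0" by blast
  define q where "q = (\<Prod>b\<in>A. [:- b, 1:])"
  have q: "poly q b = 0 \<longleftrightarrow> b \<in> A" for b
    using insert.hyps by (auto simp: q_def poly_prod)
  have "degree q = card A"
    unfolding q_def by (subst degree_prod_eq_sum_degree) auto
  define r where "r = p + smult ((f a - poly p a) / poly q a) q"
  have "poly r b = f b" if "b \<in> insert a A" for b
    using that p q[of a] q[of b] insert.hyps by (auto simp: r_def)
  moreover have "coeff r i = 0" if "i \<ge> card (insert a A)" for i
    using that insert.hyps p(2)[of i] \<open>degree q = card A\<close> by (simp add: r_def coeff_eq_0)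
  ultimately show ?case by blast
qed (auto intro: exI[of _ 0])

text \<open>The weights \<open>c\<close> are orthogonal to all polynomials in \<open>x\<close>, and
  \<open>w\<close>, being constant where \<open>x\<close> is, is interpolated by such a polynomial.
  This is a Vandermonde argument that allows repeated nodes.\<close>

lemma power_moments_vanish:
  fixes c x w :: "'i \<Rightarrow> 'a::field"
  assumes S: "finite S" and 0: "\<And>r. (\<Sum>i\<in>S. c i * x i ^ r) = 0"
    and w: "\<And>i j. i \<in> S \<Longrightarrow> j \<in> S \<Longrightarrow> x i = x j \<Longrightarrow> w i = w j"
  shows "(\<Sum>i\<in>S. c i * w i) = 0"
proof -
  define f where "f a = w (SOME i. i \<in> S \<and> x i = a)" for a
  obtain p where p: "\<And>a. a \<in> x ` S \<Longrightarrow> poly p a = f a"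
    using interpolation_exists[of "x ` S" f] S by blast
  have "w i = poly p (x i)" if "i \<in> S" for i
  proof -
    define j where "j = (SOME j. j \<in> S \<and> x j = x i)"
    have "j \<in> S \<and> x j = x i"
      unfolding j_def by (rule someI[of _ i]) (use that in simp)
    then have "w i = w j" using w that by metis
    moreover have "poly p (x i) = w j" using p[of "x i"] that by (simp add: f_def j_def)
    ultimately show ?thesis by simp
  qed
  then have "(\<Sum>i\<in>S. c i * w i) = (\<Sum>i\<in>S. \<Sum>r\<le>degree p. coeff p r * (c i * x i ^ r))"
    by (simp add: poly_altdef sum_distrib_left ac_simps)
  also have "\<dots> = (\<Sum>r\<le>degree p. coeff p r * (\<Sum>i\<in>S. c i * x i ^ r))"
    by (subst sum.swap) (simp add: sum_distrib_left)
  finally show ?thesis by (simp add: 0)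
qed

definition rat_linear :: "('k::field_char_0 \<Rightarrow> rat) \<Rightarrow> bool" where
  "rat_linear \<phi> \<longleftrightarrow> (\<forall>x y. \<phi> (x + y) = \<phi> x + \<phi> y) \<and> (\<forall>r x. \<phi> (of_rat r * x) = r * \<phi> x)"

lemma rat_linear_0: "rat_linear \<phi> \<Longrightarrow> \<phi> 0 = 0"
  unfolding rat_linear_def by (metis add_cancel_right_right)

lemma rat_linear_sum: "rat_linear \<phi> \<Longrightarrow> \<phi> (\<Sum>i\<in>A. f i) = (\<Sum>i\<in>A. \<phi> (f i))"
  by (induction A rule: infinite_finite_induct) (auto simp: rat_linear_0, auto simp: rat_linear_def)

lemma rat_linear_scale: "rat_linear \<phi> \<Longrightarrow> \<phi> (of_rat r * x) = r * \<phi> x"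
  by (simp add: rat_linear_def)

lemma rat_linear_scale_int: "rat_linear \<phi> \<Longrightarrow> \<phi> (of_int r * x) = of_int r * \<phi> x"
  using rat_linear_scale[of \<phi> "of_int r" x] by simp

text \<open>Coordinates with respect to a basis of the field over the rationals, indexed by all
  field elements; an index outside the basis gives the zero functional.\<close>

lemma rat_linear_coordinates:
  "\<exists>\<phi> :: 'k::field_char_0 \<Rightarrow> 'k \<Rightarrow> rat. (\<forall>b. rat_linear (\<phi> b)) \<and> (\<forall>v. finite {b. \<phi> b v \<noteq> 0}) \<and>
     (\<forall>v. (\<forall>b. \<phi> b v = 0) \<longrightarrow> v = 0)"
proof -
  interpret Q: vector_space "\<lambda>(r::rat) (x::'k). of_rat r * x"
    by unfold_locales (simp_all add: algebra_simps of_rat_add of_rat_mult)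
  define B where "B = Q.extend_basis {}"
  have B: "Q.independent B" "Q.span B = UNIV"
    unfolding B_def by (simp_all add: Q.independent_extend_basis Q.span_extend_basis Q.independent_empty)
  define \<phi> where "\<phi> b v = Q.representation B v b" for b v
  have "rat_linear (\<phi> b)" for b
    unfolding rat_linear_def \<phi>_def using B
    by (simp add: Q.representation_add Q.representation_scale)
  moreover have "finite {b. \<phi> b v \<noteq> 0}" for v
    unfolding \<phi>_def by (rule Q.finite_representation)
  moreover have "v = 0" if "\<forall>b. \<phi> b v = 0" for v
    using Q.sum_nonzero_representation_eq[OF B(1), of v] that B(2) by (simp add: \<phi>_def)
  ultimately show ?thesis by blast
qed

lemma rat_linear_separates:
  assumes "\<And>\<phi>. rat_linear \<phi> \<Longrightarrow> \<phi> v = 0"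
  shows "(v::'k::field_char_0) = 0"
  using rat_linear_coordinates[where 'k='k] assms by blast

lemma rat_linear_retraction: "\<exists>\<phi> :: 'k::field_char_0 \<Rightarrow> rat. rat_linear \<phi> \<and> (\<forall>r. \<phi> (of_rat r) = r)"
proof -
  obtain \<phi> :: "'k \<Rightarrow> rat" where \<phi>: "rat_linear \<phi>" "\<phi> 1 \<noteq> 0"
    using rat_linear_separates[of "1::'k"] by force
  have "rat_linear (\<lambda>x. \<phi> x / \<phi> 1)"
    using \<phi> by (auto simp: rat_linear_def add_divide_distrib)
  moreover have "\<phi> (of_rat r) / \<phi> 1 = r" for r
    using rat_linear_scale[OF \<phi>(1), of r 1] \<phi>(2) by simp
  ultimately show ?thesis by blast
qed

lemma common_denominator:
  assumes "finite A"
  shows "\<exists>N::int. N > 0 \<and> (\<forall>i\<in>A. \<exists>k. of_int N * (q i :: rat) = of_int k)"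
  using assms
proof (induction A)
  case (insert a A)
  then obtain N :: int where N: "N > 0" "\<And>i. i \<in> A \<Longrightarrow> \<exists>k. of_int N * q i = of_int k" by blast
  obtain n d where q: "q a = of_int n / of_int d" "d > 0"
    by (metis quotient_of_div quotient_of_denom_pos prod.exhaust)
  have "\<exists>k. of_int (d * N) * q i = of_int k" if "i \<in> insert a A" for i
  proof (cases "i = a")
    case True
    then have "of_int (d * N) * q i = of_int (N * n)" using q by simp
    then show ?thesis by blast
  next
    case False
    then obtain k where "of_int N * q i = of_int k" using N(2)[of i] \<open>i \<in> insert a A\<close> by blast
    then have "of_int (d * N) * q i = of_int (d * k)" by simp
    then show ?thesis by blast
  qed
  then show ?case using q N by (intro exI[of _ "d * N"]) auto
qed (auto intro: exI[of _ 1])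

section \<open>Rationality of invariant expressions in the roots\<close>

text \<open>Galois theory is replaced by the group of those permutations of the roots that preserve
  the integral linear relations between them.\<close>

locale rational_roots =
  fixes \<alpha> :: "'n::finite \<Rightarrow> 'k::field_char_0"
  assumes inj_roots: "inj \<alpha>"
    and power_sum_Rats: "\<And>m. (\<Sum>k\<in>UNIV. \<alpha> k ^ m) \<in> \<rat>"
begin

definition lin_rel :: "('n \<Rightarrow> int) \<Rightarrow> bool" where
  "lin_rel e \<longleftrightarrow> (\<Sum>k\<in>UNIV. of_int (e k) * \<alpha> k) = 0"

text \<open>Preservation of relations is required in one direction only. Finiteness makes the set a
  group, since left multiplication is injective and so reaches \<open>id\<close>; the other
  direction is then \<open>gal_lin_rel_iff\<close>.\<close>

definition gal :: "('n \<Rightarrow> 'n) set" where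
  "gal = {\<pi>. bij \<pi> \<and> (\<forall>e. lin_rel e \<longrightarrow> (\<Sum>k\<in>UNIV. of_int (e k) * \<alpha> (\<pi> k)) = 0)}"

lemma bij_gal: "\<pi> \<in> gal \<Longrightarrow> bij \<pi>"
  by (simp add: gal_def)

lemma finite_gal [simp]: "finite gal"
  by simp

lemma id_gal: "id \<in> gal"
  by (auto simp: gal_def lin_rel_def)

lemma sum_permuted:
  assumes "bij \<tau>"
  shows "(\<Sum>k\<in>UNIV. of_int (e k) * f (\<tau> k)) = (\<Sum>j\<in>UNIV. of_int (e (inv \<tau> j)) * (f j :: 'k))"
  using sum.reindex_bij_betw[OF assms, of "\<lambda>j. of_int (e (inv \<tau> j)) * f j"] assms
  by (simp add: bij_is_inj)

lemma comp_gal: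
  assumes "\<pi> \<in> gal" "\<tau> \<in> gal"
  shows "\<pi> \<circ> \<tau> \<in> gal"
proof -
  have "(\<Sum>k\<in>UNIV. of_int (e k) * \<alpha> (\<pi> (\<tau> k))) = 0" if e: "lin_rel e" for e
  proof -
    have "(\<Sum>k\<in>UNIV. of_int (e k) * \<alpha> (\<tau> k)) = 0" using assms e by (simp add: gal_def)
    then have "lin_rel (\<lambda>j. e (inv \<tau> j))"
      using sum_permuted[OF bij_gal[OF assms(2)], of e \<alpha>] by (simp add: lin_rel_def)
    then have "(\<Sum>j\<in>UNIV. of_int (e (inv \<tau> j)) * \<alpha> (\<pi> j)) = 0"
      using assms(1) by (simp add: gal_def)
    then show ?thesis
      using sum_permuted[OF bij_gal[OF assms(2)], of e "\<lambda>j. \<alpha> (\<pi> j)"] by simp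
  qed
  then show ?thesis using assms bij_comp by (auto simp: gal_def)
qed

lemma left_mult_gal: "\<pi> \<in> gal \<Longrightarrow> bij_betw ((\<circ>) \<pi>) gal gal"
proof -
  assume \<pi>: "\<pi> \<in> gal"
  have "inj_on ((\<circ>) \<pi>) gal"
    using bij_is_inj[OF bij_gal[OF \<pi>]] by (auto simp: inj_on_def fun.inj_map_strong fun_eq_iff)
  moreover have "(\<circ>) \<pi> ` gal \<subseteq> gal" using comp_gal[OF \<pi>] by blast
  ultimately show ?thesis using endo_inj_surj[OF finite_gal] by (auto simp: bij_betw_def)
qed

lemma inv_gal: "\<pi> \<in> gal \<Longrightarrow> inv \<pi> \<in> gal"
proof -
  assume \<pi>: "\<pi> \<in> gal"
  obtain \<tau> where "\<tau> \<in> gal" "\<pi> \<circ> \<tau> = id"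
    using left_mult_gal[OF \<pi>] id_gal by (metis bij_betw_imp_surj_on imageE)
  then show ?thesis using bij_gal[OF \<pi>] by (metis bij_is_inj inv_unique_comp left_right_inverse_eq inv_o_cancel)
qed

lemma right_mult_gal: "\<pi> \<in> gal \<Longrightarrow> bij_betw (\<lambda>\<tau>. \<tau> \<circ> \<pi>) gal gal"
proof (rule bij_betw_byWitness[where f' = "\<lambda>\<tau>. \<tau> \<circ> inv \<pi>"])
  assume \<pi>: "\<pi> \<in> gal"
  show "\<forall>a\<in>gal. a \<circ> \<pi> \<circ> inv \<pi> = a" "\<forall>a\<in>gal. a \<circ> inv \<pi> \<circ> \<pi> = a"
    using bij_gal[OF \<pi>] by (auto simp: fun_eq_iff bij_is_inj bij_is_surj surj_f_inv_f)
qed (auto intro: comp_gal inv_gal)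

lemma gal_lin_rel_iff:
  assumes "\<tau> \<in> gal"
  shows "(\<Sum>k\<in>UNIV. of_int (e k) * \<alpha> (\<tau> k)) = 0 \<longleftrightarrow> lin_rel e"
proof
  assume "(\<Sum>k\<in>UNIV. of_int (e k) * \<alpha> (\<tau> k)) = 0"
  then have "lin_rel (\<lambda>j. e (inv \<tau> j))"
    using sum_permuted[OF bij_gal[OF assms], of e \<alpha>] by (simp add: lin_rel_def)
  then have "(\<Sum>j\<in>UNIV. of_int (e (inv \<tau> j)) * \<alpha> (inv \<tau> j)) = 0"
    using inv_gal[OF assms] by (simp add: gal_def)
  then show "lin_rel e"
    using sum_permuted[OF bij_gal[OF assms], of e "\<lambda>j. \<alpha> (inv \<tau> j)"] bij_gal[OF assms]
    by (simp add: lin_rel_def bij_is_inj)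
qed (use assms in \<open>simp add: gal_def\<close>)

section \<open>Averaging over all self-maps of the index set\<close>

lemma sum_all_maps_Rats:
  assumes "polyfun \<rat> F"
  shows "(\<Sum>f\<in>(UNIV :: ('n \<Rightarrow> 'n) set). F (\<lambda>k. \<alpha> (f k))) \<in> \<rat>"
proof -
  obtain N :: nat and c m where c: "\<And>i. i < N \<Longrightarrow> c i \<in> \<rat>"
    and F: "\<And>x. F x = (\<Sum>i<N. c i * (\<Prod>v\<in>UNIV. x v ^ m i v))"
    using polyfun_normal_form[OF coeff_ring_Rats assms] by blast
  have "(\<Sum>f\<in>(UNIV :: ('n \<Rightarrow> 'n) set). F (\<lambda>k. \<alpha> (f k)))
      = (\<Sum>i<N. c i * (\<Sum>f\<in>(UNIV :: ('n \<Rightarrow> 'n) set). \<Prod>v\<in>UNIV. \<alpha> (f v) ^ m i v))"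
    unfolding F by (subst sum.swap) (simp add: sum_distrib_left)
  \<comment> \<open>The values of \<open>f\<close> are chosen independently, so the distributive law
    turns the sum of products into a product of power sums.\<close>
  also have "\<dots> = (\<Sum>i<N. c i * (\<Prod>v\<in>UNIV. \<Sum>k\<in>UNIV. \<alpha> k ^ m i v))"
    by (subst prod_sum_PiE) (simp_all add: PiE_UNIV_domain)
  also have "\<dots> \<in> \<rat>"
    by (intro Rats_sum Rats_mult Rats_prod c power_sum_Rats) auto
  finally show ?thesis .
qed

text \<open>Symmetrising over all self-maps of the index set, not only over permutations, gives
  products of power sums at once. The indicator \<open>U\<close> then discards the maps outside \<open>gal\<close>: a
  product of differences vanishes at non-injective maps, and for a permutation \<open>f\<close> outside
  \<open>gal\<close> the relation broken by \<open>inv f\<close> yields a vanishing factor at \<open>f\<close>.\<close>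

lemma gal_indicator_exists:
  "\<exists>U D. polyfun \<rat> U \<and> D \<noteq> 0 \<and> (\<forall>f. U (\<lambda>k. \<alpha> (f k)) = (if f \<in> gal then D else 0))"
proof -
  define A where "A = {\<sigma>::'n \<Rightarrow> 'n. bij \<sigma>} - gal"
  have "\<exists>e. lin_rel e \<and> (\<Sum>k\<in>UNIV. of_int (e k) * \<alpha> (\<sigma> k)) \<noteq> 0" if "\<sigma> \<in> A" for \<sigma>
    using that by (auto simp: A_def gal_def)
  then obtain e where e: "\<And>\<sigma>. \<sigma> \<in> A \<Longrightarrow> lin_rel (e \<sigma>)"
    "\<And>\<sigma>. \<sigma> \<in> A \<Longrightarrow> (\<Sum>k\<in>UNIV. of_int (e \<sigma> k) * \<alpha> (\<sigma> k)) \<noteq> 0"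
    by metis
  define U0 where "U0 z = (\<Prod>\<sigma>\<in>A. \<Sum>k\<in>UNIV. of_int (e \<sigma> k) * z (\<sigma> k))" for z :: "'n \<Rightarrow> 'k"
  \<comment> \<open>Ordered pairs are taken, so that permuting the roots leaves \<open>V\<close>
    fixed with no sign.\<close>
  define T where "T = {p::'n \<times> 'n. fst p \<noteq> snd p}"
  define V where "V z = (\<Prod>p\<in>T. z (fst p) - z (snd p))" for z :: "'n \<Rightarrow> 'k"
  \<comment> \<open>The product over \<open>gal\<close> makes \<open>U\<close> take one and the same
    value at all points of the \<open>gal\<close>-orbit.\<close>
  define U where "U z = V z * (\<Prod>\<tau>\<in>gal. U0 (\<lambda>k. z (\<tau> k)))" for z
  have "polyfun \<rat> U"
    unfolding U_def U0_def V_def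
    by (intro polyfun_mult polyfun_prod polyfun_sum polyfun_diff polyfun_var polyfun.const
        coeff_ring_Rats Rats_of_int)
  moreover have "U \<alpha> \<noteq> 0"
  proof -
    have "V \<alpha> \<noteq> 0" using inj_roots by (auto simp: V_def T_def inj_eq)
    moreover have "U0 (\<lambda>k. \<alpha> (\<tau> k)) \<noteq> 0" if \<tau>: "\<tau> \<in> gal" for \<tau>
    proof -
      have "(\<Sum>k\<in>UNIV. of_int (e \<sigma> k) * \<alpha> (\<tau> (\<sigma> k))) \<noteq> 0" if \<sigma>: "\<sigma> \<in> A" for \<sigma>
      proof
        have b: "bij \<sigma>" using \<sigma> by (simp add: A_def)
        assume "(\<Sum>k\<in>UNIV. of_int (e \<sigma> k) * \<alpha> (\<tau> (\<sigma> k))) = 0"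
        then have "lin_rel (\<lambda>j. e \<sigma> (inv \<sigma> j))"
          using sum_permuted[OF b, of "e \<sigma>" "\<lambda>j. \<alpha> (\<tau> j)"] gal_lin_rel_iff[OF \<tau>] by simp
        then show False using e(2)[OF \<sigma>] sum_permuted[OF b, of "e \<sigma>" \<alpha>] by (simp add: lin_rel_def)
      qed
      then show ?thesis by (simp add: U0_def)
    qed
    ultimately show ?thesis by (simp add: U_def)
  qed
  moreover have "U (\<lambda>k. \<alpha> (f k)) = (if f \<in> gal then U \<alpha> else 0)" for f
  proof (cases "f \<in> gal")
    case True
    have "bij_betw (map_prod f f) T T"
      using bij_gal[OF True]
      by (intro bij_betw_byWitness[where f' = "map_prod (inv f) (inv f)"])
        (auto simp: T_def map_prod_def bij_is_inj bij_is_surj surj_f_inv_f inj_eq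
          bij_imp_bij_inv)
    then have "V (\<lambda>k. \<alpha> (f k)) = V \<alpha>"
      using prod.reindex_bij_betw[of "map_prod f f" T T "\<lambda>p. \<alpha> (fst p) - \<alpha> (snd p)"]
      by (simp add: V_def)
    moreover have "(\<Prod>\<tau>\<in>gal. U0 (\<lambda>k. \<alpha> (f (\<tau> k)))) = (\<Prod>\<tau>\<in>gal. U0 (\<lambda>k. \<alpha> (\<tau> k)))"
      using prod.reindex_bij_betw[OF left_mult_gal[OF True], of "\<lambda>\<tau>. U0 (\<lambda>k. \<alpha> (\<tau> k))"] by simp
    ultimately show ?thesis using True by (simp add: U_def)
  next
    case False
    show ?thesis
    proof (cases "bij f")
      case True
      then have "inv f \<in> A" using False inv_gal[of "inv f"] by (auto simp: A_def bij_imp_bij_inv inv_inv_eq)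
      moreover have "(\<Sum>k\<in>UNIV. of_int (e (inv f) k) * \<alpha> (f (inv f k))) = 0"
        using e(1)[OF \<open>inv f \<in> A\<close>] True by (simp add: lin_rel_def bij_is_surj surj_f_inv_f)
      ultimately have "U0 (\<lambda>k. \<alpha> (f k)) = 0"
        unfolding U0_def by (intro prod_zero) auto
      then have "(\<Prod>\<tau>\<in>gal. U0 (\<lambda>k. \<alpha> (f (\<tau> k)))) = 0"
        using id_gal by (intro prod_zero bexI[of _ id]) auto
      then show ?thesis using False by (simp add: U_def)
    next
      case nb: False
      then have "\<not> inj f" using finite_UNIV_inj_surj[of f] by (auto simp: bij_def)
      then obtain i j where "i \<noteq> j" "f i = f j" by (auto simp: inj_on_def)
      then have "V (\<lambda>k. \<alpha> (f k)) = 0"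
        unfolding V_def by (intro prod_zero bexI[of _ "(i, j)"]) (auto simp: T_def)
      then show ?thesis using False by (simp add: U_def)
    qed
  qed
  ultimately show ?thesis by blast
qed

text \<open>Takes the place of the fixed field theorem. Weighted with \<open>U\<close>, the sum over
  all maps collapses to \<open>card gal * D * F \<alpha>\<close>, which is therefore rational; the
  constant 1 in place of \<open>F\<close> shows that the factor \<open>card gal * D\<close> is
  rational too, and it is nonzero.\<close>

lemma gal_invariant_Rats:
  assumes F: "polyfun \<rat> F" and inv: "\<And>\<pi>. \<pi> \<in> gal \<Longrightarrow> F (\<lambda>k. \<alpha> (\<pi> k)) = F \<alpha>"
  shows "F \<alpha> \<in> \<rat>"
proof -
  obtain U D where U: "polyfun \<rat> U" "D \<noteq> 0" "\<And>f. U (\<lambda>k. \<alpha> (f k)) = (if f \<in> gal then D else 0)"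
    using gal_indicator_exists by blast
  have *: "of_nat (card gal) * D * G \<alpha> \<in> \<rat>"
    if G: "polyfun \<rat> G" "\<And>\<pi>. \<pi> \<in> gal \<Longrightarrow> G (\<lambda>k. \<alpha> (\<pi> k)) = G \<alpha>" for G
  proof -
    have "(\<Sum>f\<in>(UNIV :: ('n \<Rightarrow> 'n) set). U (\<lambda>k. \<alpha> (f k)) * G (\<lambda>k. \<alpha> (f k))) \<in> \<rat>"
      by (rule sum_all_maps_Rats) (intro polyfun_mult coeff_ring_Rats U G)
    also have "(\<Sum>f\<in>(UNIV :: ('n \<Rightarrow> 'n) set). U (\<lambda>k. \<alpha> (f k)) * G (\<lambda>k. \<alpha> (f k)))
        = (\<Sum>f\<in>gal. D * G \<alpha>)"
      by (intro sum.mono_neutral_cong_right) (auto simp: U G)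
    finally show ?thesis by (simp add: mult.assoc)
  qed
  have "of_nat (card gal) * D \<in> \<rat>"
    using *[of "\<lambda>_. 1"] by (simp add: polyfun.const)
  moreover have "of_nat (card gal) * D * F \<alpha> \<in> \<rat>" using *[OF F inv] .
  moreover have "of_nat (card gal) * D \<noteq> 0"
    using U(2) id_gal finite_gal by (auto simp: card_eq_0_iff)
  ultimately show ?thesis
    using Rats_divide[of "of_nat (card gal) * D * F \<alpha>" "of_nat (card gal) * D"] by simp
qed

end

section \<open>A point of the torus separating characters\<close>

lemma power_int_sum:
  assumes "(x::'a::field) \<noteq> 0"
  shows "x powi (\<Sum>i\<in>A. f i) = (\<Prod>i\<in>A. x powi f i)"
  using assms by (induction A rule: infinite_finite_induct) (simp_all add: power_int_add)

lemma power_int_conv_divide: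
  assumes "(x::'a::field) \<noteq> 0"
  shows "x powi i = x ^ nat i / x ^ nat (- i)"
  by (cases "i \<ge> 0") (auto simp: power_int_def power_inverse divide_simps)

text \<open>Splitting exponents into positive and negative parts turns an equation between
  characters into a polynomial equation, the shape used for the torus.\<close>

lemma prod_power_int_eq_1_iff:
  assumes "\<And>k. k \<in> A \<Longrightarrow> (x k :: 'a::field) \<noteq> 0"
  shows "(\<Prod>k\<in>A. x k powi c k) = 1 \<longleftrightarrow> (\<Prod>k\<in>A. x k ^ nat (c k)) = (\<Prod>k\<in>A. x k ^ nat (- c k))"
proof -
  have "(\<Prod>k\<in>A. x k powi c k) = (\<Prod>k\<in>A. x k ^ nat (c k)) / (\<Prod>k\<in>A. x k ^ nat (- c k))"
    unfolding prod_dividef[symmetric] using assms by (intro prod.cong) (auto simp: power_int_conv_divide)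
  moreover have "(\<Prod>k\<in>A. x k ^ nat (- c k)) \<noteq> 0"
    using assms by (cases "finite A") auto
  ultimately show ?thesis by (simp add: divide_eq_1_iff)
qed

text \<open>All factors are 1 at the origin, so the product rule leaves only the sum of their
  derivatives.\<close>

lemma coeff_1_prod_linear_powers:
  fixes a :: "'n::finite \<Rightarrow> 'k::field_char_0"
  shows "coeff (\<Prod>k\<in>UNIV. [:1, a k:] ^ m k) 1 = (\<Sum>k\<in>UNIV. of_nat (m k) * a k)"
  unfolding coeff_1_conv_pderiv
  by (simp add: pderiv_prod pderiv_power poly_sum poly_prod pderiv_pCons)

text \<open>With denominators cleared, the condition is a polynomial equation in \<open>s\<close>
  whose linear coefficient is the given nonzero sum; such a polynomial has finitely many
  roots.\<close>

lemma finite_bad_parameters: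
  fixes \<alpha> :: "'n::finite \<Rightarrow> 'k::field_char_0"
  assumes "(\<Sum>k\<in>UNIV. of_int (c k) * \<alpha> k) \<noteq> 0"
  shows "finite {s. (\<forall>k. 1 + s * \<alpha> k \<noteq> 0) \<and> (\<Prod>k\<in>UNIV. (1 + s * \<alpha> k) powi c k) = 1}"
proof -
  define P where "P d = (\<Prod>k\<in>UNIV. [:1, \<alpha> k:] ^ nat (d k))" for d :: "'n \<Rightarrow> int"
  have coeff: "coeff (P d) 1 = (\<Sum>k\<in>UNIV. of_nat (nat (d k)) * \<alpha> k)" for d
    unfolding P_def by (rule coeff_1_prod_linear_powers)
  have eq: "of_nat (nat i) - of_nat (nat (- i)) = (of_int i :: 'k)" for i
    by (cases "i \<ge> 0") auto
  have "coeff (P c - P (\<lambda>k. - c k)) 1 = (\<Sum>k\<in>UNIV. of_int (c k) * \<alpha> k)"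
    unfolding coeff_diff coeff sum_subtractf[symmetric] left_diff_distrib[symmetric] eq ..
  then have "P c - P (\<lambda>k. - c k) \<noteq> 0" using assms by auto
  then have "finite {s. poly (P c - P (\<lambda>k. - c k)) s = 0}" by (rule poly_roots_finite)
  moreover have "{s. (\<forall>k. 1 + s * \<alpha> k \<noteq> 0) \<and> (\<Prod>k\<in>UNIV. (1 + s * \<alpha> k) powi c k) = 1}
      \<subseteq> {s. poly (P c - P (\<lambda>k. - c k)) s = 0}"
    by (auto simp: prod_power_int_eq_1_iff P_def poly_prod)
  ultimately show ?thesis by (rule finite_subset[rotated])
qed

context rational_roots
begin

text \<open>Up to a scalar, \<open>M\<close> is the sum over \<open>gal\<close> of the Gram matrices of the permuted roots with
  respect to rational coordinates. Its rows are one-parameter subgroups of the torus cut out by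
  the relations; the last property holds because \<open>M\<close> is symmetric and positive semidefinite.\<close>

lemma equivariant_Gram_matrix:
  "\<exists>M :: 'n \<Rightarrow> 'n \<Rightarrow> int.
     (\<forall>\<pi>\<in>gal. \<forall>j k. M (\<pi> j) (\<pi> k) = M j k) \<and>
     (\<forall>e k. lin_rel e \<longrightarrow> (\<Sum>j\<in>UNIV. e j * M j k) = 0) \<and>
     (\<forall>m. lin_rel (\<lambda>k. \<Sum>j\<in>UNIV. m j * M j k) \<longrightarrow> lin_rel m)"
proof -
  obtain \<phi> :: "'k \<Rightarrow> 'k \<Rightarrow> rat" where \<phi>: "\<And>b. rat_linear (\<phi> b)" "\<And>v. finite {b. \<phi> b v \<noteq> 0}"
    "\<And>v. (\<And>b. \<phi> b v = 0) \<Longrightarrow> v = 0"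
    using rat_linear_coordinates[where 'k='k] by blast
  define B where "B = (\<Union>k. {b. \<phi> b (\<alpha> k) \<noteq> 0})"
  have B: "finite B" unfolding B_def using \<phi>(2) by auto
  \<comment> \<open>Summing over the group gives equivariance, by reindexing with a right
    translation. \<open>B\<close> collects the finitely many coordinates in which some root is
    nonzero; \<open>N\<close> then makes all entries integral exponents.\<close>
  define q where "q j k = (\<Sum>b\<in>B. \<Sum>\<pi>\<in>gal. \<phi> b (\<alpha> (\<pi> j)) * \<phi> b (\<alpha> (\<pi> k)))" for j k
  obtain N :: int where N: "N > 0" "\<And>p. \<exists>i. of_int N * q (fst p) (snd p) = of_int i"
    using common_denominator[of "UNIV :: ('n \<times> 'n) set" "\<lambda>p. q (fst p) (snd p)"] by auto
  obtain M where M: "\<And>j k. of_int (M j k) = of_int N * q j k"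
    using N(2)[of "(_, _)"] by (simp, metis)
  have sum_\<phi>: "(\<Sum>j\<in>UNIV. of_int (m j) * \<phi> b (\<alpha> (\<pi> j))) = \<phi> b (\<Sum>j\<in>UNIV. of_int (m j) * \<alpha> (\<pi> j))"
    for m b \<pi>
    by (simp add: rat_linear_sum[OF \<phi>(1)] rat_linear_scale_int[OF \<phi>(1)])
  have row: "of_int (\<Sum>j\<in>UNIV. m j * M j k) = of_int N *
      (\<Sum>b\<in>B. \<Sum>\<pi>\<in>gal. \<phi> b (\<Sum>j\<in>UNIV. of_int (m j) * \<alpha> (\<pi> j)) * \<phi> b (\<alpha> (\<pi> k)))" for m k
  proof -
    have "of_int (\<Sum>j\<in>UNIV. m j * M j k) = of_int N * (\<Sum>j\<in>UNIV. \<Sum>b\<in>B. \<Sum>\<pi>\<in>gal.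
        of_int (m j) * \<phi> b (\<alpha> (\<pi> j)) * \<phi> b (\<alpha> (\<pi> k)))"
      by (simp add: M q_def sum_distrib_left ac_simps)
    also have "(\<Sum>j\<in>UNIV. \<Sum>b\<in>B. \<Sum>\<pi>\<in>gal. of_int (m j) * \<phi> b (\<alpha> (\<pi> j)) * \<phi> b (\<alpha> (\<pi> k)))
        = (\<Sum>b\<in>B. \<Sum>\<pi>\<in>gal. \<Sum>j\<in>UNIV. of_int (m j) * \<phi> b (\<alpha> (\<pi> j)) * \<phi> b (\<alpha> (\<pi> k)))"
      by (subst sum.swap, intro sum.cong refl, subst sum.swap, rule refl)
    finally show ?thesis by (simp add: sum_\<phi> flip: sum_distrib_right)
  qed
  have sym: "M j k = M k j" for j k
  proof -
    have "(of_int (M j k) :: rat) = of_int (M k j)" by (simp add: M q_def mult.commute)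
    then show ?thesis by simp
  qed
  \<comment> \<open>Every permutation in \<open>gal\<close> preserves the relation, so the inner
    linear form vanishes in each summand of \<open>row\<close>.\<close>
  have kill: "(\<Sum>j\<in>UNIV. e j * M j k) = 0" if "lin_rel e" for e k
  proof -
    have "(of_int (\<Sum>j\<in>UNIV. e j * M j k) :: rat) = 0"
      unfolding row using that by (auto simp: gal_def rat_linear_0[OF \<phi>(1)])
    then show ?thesis by (simp only: of_int_eq_0_iff)
  qed
  have "M (\<pi> j) (\<pi> k) = M j k" if "\<pi> \<in> gal" for \<pi> j k
  proof -
    have "q (\<pi> j) (\<pi> k) = q j k"
      unfolding q_def
      using sum.reindex_bij_betw[OF right_mult_gal[OF that], of "\<lambda>\<tau>. \<phi> b (\<alpha> (\<tau> j)) * \<phi> b (\<alpha> (\<tau> k))" for b]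
      by simp
    then have "(of_int (M (\<pi> j) (\<pi> k)) :: rat) = of_int (M j k)" by (simp add: M)
    then show ?thesis by simp
  qed
  \<comment> \<open>Put c = mM. Since c is a relation, cM = 0, and symmetry gives c.c = m.(cM) = 0,
    so c = 0. Pairing mM = 0 with m yields a sum of squares of the coordinates of the permuted
    m.\<alpha>; the terms for \<open>id\<close> show m.\<alpha> = 0.\<close>
  moreover have "lin_rel m" if rel: "lin_rel (\<lambda>k. \<Sum>j\<in>UNIV. m j * M j k)" for m
  proof -
    define c where "c k = (\<Sum>j\<in>UNIV. m j * M j k)" for k
    have c0: "(\<Sum>k\<in>UNIV. c k * M k l) = 0" for l
      using kill[OF rel] by (simp add: c_def)
    have "(\<Sum>k\<in>UNIV. c k * c k) = (\<Sum>k\<in>UNIV. \<Sum>j\<in>UNIV. m j * (c k * M k j))"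
    proof (intro sum.cong refl)
      fix k
      show "c k * c k = (\<Sum>j\<in>UNIV. m j * (c k * M k j))"
        by (subst (2) c_def) (simp add: sum_distrib_left sym[of _ k] ac_simps)
    qed
    also have "\<dots> = (\<Sum>j\<in>UNIV. m j * (\<Sum>k\<in>UNIV. c k * M k j))"
      by (subst sum.swap) (simp add: sum_distrib_left)
    also have "\<dots> = 0" by (simp add: c0)
    finally have "c k = 0" for k by (simp add: sum_nonneg_eq_0_iff)
    then have row0: "(\<Sum>b\<in>B. \<Sum>\<pi>\<in>gal. \<phi> b (\<Sum>j\<in>UNIV. of_int (m j) * \<alpha> (\<pi> j)) * \<phi> b (\<alpha> (\<pi> k))) = 0" for k
      using row[of m k] N(1) by (simp add: c_def)
    have "0 = (\<Sum>k\<in>UNIV. of_int (m k) *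
        (\<Sum>b\<in>B. \<Sum>\<pi>\<in>gal. \<phi> b (\<Sum>j\<in>UNIV. of_int (m j) * \<alpha> (\<pi> j)) * \<phi> b (\<alpha> (\<pi> k))))"
      by (simp add: row0)
    also have "\<dots> = (\<Sum>k\<in>UNIV. \<Sum>b\<in>B. \<Sum>\<pi>\<in>gal. \<phi> b (\<Sum>j\<in>UNIV. of_int (m j) * \<alpha> (\<pi> j)) *
        (of_int (m k) * \<phi> b (\<alpha> (\<pi> k))))"
      by (simp add: sum_distrib_left ac_simps)
    also have "\<dots> = (\<Sum>b\<in>B. \<Sum>\<pi>\<in>gal. \<Sum>k\<in>UNIV. \<phi> b (\<Sum>j\<in>UNIV. of_int (m j) * \<alpha> (\<pi> j)) *
        (of_int (m k) * \<phi> b (\<alpha> (\<pi> k))))"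
      by (subst sum.swap, intro sum.cong refl, subst sum.swap, rule refl)
    also have "\<dots> = (\<Sum>b\<in>B. \<Sum>\<pi>\<in>gal. (\<phi> b (\<Sum>j\<in>UNIV. of_int (m j) * \<alpha> (\<pi> j)))\<^sup>2)"
      by (simp add: sum_\<phi> power2_eq_square flip: sum_distrib_left)
    finally have "\<forall>b\<in>B. (\<Sum>\<pi>\<in>gal. (\<phi> b (\<Sum>j\<in>UNIV. of_int (m j) * \<alpha> (\<pi> j)))\<^sup>2) = 0"
      by (subst (asm) eq_commute) (subst (asm) sum_nonneg_eq_0_iff, auto intro: B sum_nonneg)
    then have "\<forall>b\<in>B. \<forall>\<pi>\<in>gal. \<phi> b (\<Sum>j\<in>UNIV. of_int (m j) * \<alpha> (\<pi> j)) = 0"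
      by (simp add: sum_nonneg_eq_0_iff)
    then have "\<phi> b (\<Sum>j\<in>UNIV. of_int (m j) * \<alpha> j) = 0" if "b \<in> B" for b
      using id_gal that by fastforce
    moreover have "\<phi> b (\<Sum>j\<in>UNIV. of_int (m j) * \<alpha> j) = 0" if "b \<notin> B" for b
      using that sum_\<phi>[of m b id] by (simp add: B_def)
    ultimately show ?thesis unfolding lin_rel_def by (intro \<phi>(3)) blast
  qed
  ultimately show ?thesis using kill by blast
qed

text \<open>Rational sums of \<open>\<alpha> j ^ i * y j\<close> are the traces that make
  \<open>y\<close> the spectrum of a rational matrix (\<open>rational_spectrum\<close>). The finite
  set \<open>S\<close> will hold the exponents of a given polynomial.\<close>

lemma separating_torus_point:
  fixes S :: "('n \<Rightarrow> nat) set"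
  assumes "finite S"
  shows "\<exists>y::'n \<Rightarrow> 'k. (\<forall>j. y j \<noteq> 0) \<and> (\<forall>i. (\<Sum>j\<in>UNIV. \<alpha> j ^ i * y j) \<in> \<rat>) \<and>
     (\<forall>e. lin_rel e \<longrightarrow> (\<Prod>j\<in>UNIV. y j ^ nat (e j)) = (\<Prod>j\<in>UNIV. y j ^ nat (- e j))) \<and>
     (\<forall>m\<in>S. \<forall>m'\<in>S. (\<Prod>j\<in>UNIV. y j ^ m j) = (\<Prod>j\<in>UNIV. y j ^ m' j) \<longrightarrow>
        lin_rel (\<lambda>j. int (m j) - int (m' j)))"
proof -
  obtain M :: "'n \<Rightarrow> 'n \<Rightarrow> int" where
    equi: "\<And>\<pi> j k. \<pi> \<in> gal \<Longrightarrow> M (\<pi> j) (\<pi> k) = M j k" and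
    kill: "\<And>e k. lin_rel e \<Longrightarrow> (\<Sum>j\<in>UNIV. e j * M j k) = 0" and
    sep: "\<And>m. lin_rel (\<lambda>k. \<Sum>j\<in>UNIV. m j * M j k) \<Longrightarrow> lin_rel m"
    using equivariant_Gram_matrix by blast
  \<comment> \<open>\<open>c (m, m')\<close> is the exponent vector of the character m - m' when
    rewritten in the numbers 1 + s \<alpha>_k.\<close>
  define c where "c p k = (\<Sum>j\<in>UNIV. (int (fst p j) - int (snd p j)) * M j k)"
    for p :: "('n \<Rightarrow> nat) \<times> ('n \<Rightarrow> nat)" and k
  \<comment> \<open>Excluded are the parameters for which some 1 + s \<alpha>_k vanishes and those
    at which two characters to be separated coincide by accident; both sets are finite, so a
    rational parameter remains.\<close>
  define bad where "bad = (\<Union>k. {s. 1 + s * \<alpha> k = 0}) \<union>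
    (\<Union>p\<in>{p \<in> S \<times> S. \<not> lin_rel (c p)}.
       {s. (\<forall>k. 1 + s * \<alpha> k \<noteq> 0) \<and> (\<Prod>k\<in>UNIV. (1 + s * \<alpha> k) powi c p k) = 1})"
  have "finite {s. 1 + s * \<alpha> k = 0}" for k
  proof (rule finite_subset)
    show "{s. 1 + s * \<alpha> k = 0} \<subseteq> {- 1 / \<alpha> k}"
    proof safe
      fix s assume "1 + s * \<alpha> k = 0"
      then have "s * \<alpha> k = - 1" by (metis add_eq_0_iff)
      moreover from this have "\<alpha> k \<noteq> 0" by auto
      ultimately show "s = - 1 / \<alpha> k" by (subst nonzero_eq_divide_eq)
    qed
  qed simp
  moreover have "finite {s. (\<forall>k. 1 + s * \<alpha> k \<noteq> 0) \<and> (\<Prod>k\<in>UNIV. (1 + s * \<alpha> k) powi c p k) = 1}"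
    if "\<not> lin_rel (c p)" for p
    using that by (intro finite_bad_parameters) (simp add: lin_rel_def)
  ultimately have "finite bad" unfolding bad_def using assms by auto
  moreover have "infinite (range (of_rat :: rat \<Rightarrow> 'k))"
    using finite_imageD[of of_rat UNIV] infinite_UNIV_char_0 by (auto simp: inj_on_def)
  ultimately obtain r :: rat where r: "of_rat r \<notin> bad" by (metis finite_subset image_subsetI)
  define x where "x k = 1 + of_rat r * \<alpha> k" for k
  have x0: "x k \<noteq> 0" for k using r by (auto simp: bad_def x_def)
  \<comment> \<open>A bound for all entries of \<open>M\<close>. Shifting every exponent by the same
    \<open>K\<close> makes \<open>y j\<close> a quotient of polynomial expressions whose denominator
    does not depend on \<open>j\<close>; numerator sum and denominator are then separately
    \<open>gal\<close>-invariant.\<close>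
  define K where "K = (\<Sum>j\<in>UNIV. \<Sum>k\<in>UNIV. \<bar>M j k\<bar>)"
  have K: "0 \<le> M j k + K" "0 \<le> K" for j k
  proof -
    have "\<bar>M j k\<bar> \<le> (\<Sum>k\<in>UNIV. \<bar>M j k\<bar>)" by (rule member_le_sum) auto
    also have "\<dots> \<le> K" unfolding K_def by (rule member_le_sum[of j]) (auto intro: sum_nonneg)
    finally show "0 \<le> M j k + K" "0 \<le> K" by auto
  qed
  define y where "y j = (\<Prod>k\<in>UNIV. x k powi M j k)" for j
  have y_pow: "(\<Prod>j\<in>UNIV. y j powi a j) = (\<Prod>k\<in>UNIV. x k powi (\<Sum>j\<in>UNIV. a j * M j k))" for a
  proof -
    have pd: "(\<Prod>k\<in>A. f k) powi i = (\<Prod>k\<in>A. f k powi i)" for f :: "'n \<Rightarrow> 'k" and A i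
      by (induction A rule: infinite_finite_induct) (simp_all add: power_int_mult_distrib)
    have "(\<Prod>j\<in>UNIV. y j powi a j) = (\<Prod>j\<in>UNIV. \<Prod>k\<in>UNIV. x k powi (a j * M j k))"
      by (simp add: y_def pd power_int_mult[symmetric] mult.commute)
    also have "\<dots> = (\<Prod>k\<in>UNIV. \<Prod>j\<in>UNIV. x k powi (a j * M j k))" by (rule prod.swap)
    finally show ?thesis by (simp add: power_int_sum x0)
  qed
  have y0: "y j \<noteq> 0" for j by (simp add: y_def x0)
  have y_eq: "y j = (\<Prod>k\<in>UNIV. x k ^ nat (M j k + K)) / (\<Prod>k\<in>UNIV. x k ^ nat K)" for j
  proof -
    have "x k powi M j k = x k ^ nat (M j k + K) / x k ^ nat K" for k
      using power_int_diff[of "x k" "M j k + K" K] x0[of k] K(1)[of j k] K(2)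
      by (simp add: power_int_nonneg_exp)
    then show ?thesis by (simp add: y_def prod_dividef)
  qed
  have rat: "(\<Sum>j\<in>UNIV. \<alpha> j ^ i * y j) \<in> \<rat>" for i
  proof -
    have "(\<Sum>j\<in>UNIV. \<alpha> j ^ i * (\<Prod>k\<in>UNIV. (1 + of_rat r * \<alpha> k) ^ nat (M j k + K))) \<in> \<rat>"
    proof (rule gal_invariant_Rats[where F = "\<lambda>z. \<Sum>j\<in>UNIV. z j ^ i * (\<Prod>k\<in>UNIV. (1 + of_rat r * z k) ^ nat (M j k + K))"])
      fix \<pi> assume \<pi>: "\<pi> \<in> gal"
      have "(\<Sum>j\<in>UNIV. \<alpha> (\<pi> j) ^ i * (\<Prod>k\<in>UNIV. (1 + of_rat r * \<alpha> (\<pi> k)) ^ nat (M j k + K)))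
        = (\<Sum>j\<in>UNIV. \<alpha> (\<pi> j) ^ i * (\<Prod>k\<in>UNIV. (1 + of_rat r * \<alpha> (\<pi> k)) ^ nat (M (\<pi> j) (\<pi> k) + K)))"
        by (simp add: equi[OF \<pi>])
      also have "\<dots> = (\<Sum>j\<in>UNIV. \<alpha> (\<pi> j) ^ i * (\<Prod>k\<in>UNIV. (1 + of_rat r * \<alpha> k) ^ nat (M (\<pi> j) k + K)))"
        by (intro sum.cong refl arg_cong2[of _ _ _ _ "(*)"] prod.reindex_bij_betw[OF bij_gal[OF \<pi>]])
      also have "\<dots> = (\<Sum>j\<in>UNIV. \<alpha> j ^ i * (\<Prod>k\<in>UNIV. (1 + of_rat r * \<alpha> k) ^ nat (M j k + K)))"
        by (rule sum.reindex_bij_betw[OF bij_gal[OF \<pi>]])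
      finally show "(\<Sum>j\<in>UNIV. \<alpha> (\<pi> j) ^ i * (\<Prod>k\<in>UNIV. (1 + of_rat r * \<alpha> (\<pi> k)) ^ nat (M j k + K)))
        = (\<Sum>j\<in>UNIV. \<alpha> j ^ i * (\<Prod>k\<in>UNIV. (1 + of_rat r * \<alpha> k) ^ nat (M j k + K)))" .
    qed (intro polyfun_sum polyfun_mult polyfun_power polyfun_prod polyfun.add polyfun_var
        polyfun.const coeff_ring_Rats Rats_1 Rats_of_rat)
    moreover have "(\<Prod>k\<in>UNIV. (1 + of_rat r * \<alpha> k) ^ nat K) \<in> \<rat>"
    proof (rule gal_invariant_Rats[where F = "\<lambda>z. \<Prod>k\<in>UNIV. (1 + of_rat r * z k) ^ nat K"])
      fix \<pi> assume \<pi>: "\<pi> \<in> gal"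
      show "(\<Prod>k\<in>UNIV. (1 + of_rat r * \<alpha> (\<pi> k)) ^ nat K) = (\<Prod>k\<in>UNIV. (1 + of_rat r * \<alpha> k) ^ nat K)"
        by (rule prod.reindex_bij_betw[OF bij_gal[OF \<pi>]])
    qed (intro polyfun_mult polyfun_power polyfun_prod polyfun.add polyfun_var
        polyfun.const coeff_ring_Rats Rats_1 Rats_of_rat)
    ultimately have "(\<Sum>j\<in>UNIV. \<alpha> j ^ i * (\<Prod>k\<in>UNIV. x k ^ nat (M j k + K))) / (\<Prod>k\<in>UNIV. x k ^ nat K) \<in> \<rat>"
      unfolding x_def by (rule Rats_divide)
    then show ?thesis by (simp add: y_eq sum_divide_distrib)
  qed
  have rel: "(\<Prod>j\<in>UNIV. y j ^ nat (e j)) = (\<Prod>j\<in>UNIV. y j ^ nat (- e j))" if "lin_rel e" for e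
    using y_pow[of e] kill[OF that] prod_power_int_eq_1_iff[of UNIV y e] y0 by simp
  have sepm: "lin_rel (\<lambda>j. int (m j) - int (m' j))"
    if m: "m \<in> S" "m' \<in> S" and eq: "(\<Prod>j\<in>UNIV. y j ^ m j) = (\<Prod>j\<in>UNIV. y j ^ m' j)" for m m'
  proof -
    have "(\<Prod>j\<in>UNIV. y j powi (int (m j) - int (m' j))) = (\<Prod>j\<in>UNIV. y j ^ m j) / (\<Prod>j\<in>UNIV. y j ^ m' j)"
      by (simp add: power_int_diff y0 prod_dividef)
    also have "\<dots> = 1" using eq y0 by simp
    finally have "(\<Prod>k\<in>UNIV. x k powi c (m, m') k) = 1"
      by (simp add: y_pow c_def)
    then have "lin_rel (c (m, m'))"
      using r m x0 unfolding bad_def x_def by blast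
    then have "lin_rel (\<lambda>k. \<Sum>j\<in>UNIV. (int (m j) - int (m' j)) * M j k)"
      by (simp add: c_def[abs_def])
    then show ?thesis by (rule sep)
  qed
  show ?thesis using y0 rat rel sepm by blast
qed

end

section \<open>Rational matrices over the splitting field\<close>

definition emb :: "rat^'n^'m \<Rightarrow> 'k::field_char_0^'n^'m" where
  "emb A = (\<chi> i j. of_rat (A $ i $ j))"

lemma of_rat_sum: "(of_rat (\<Sum>i\<in>A. f i) :: 'k::field_char_0) = (\<Sum>i\<in>A. of_rat (f i))"
  by (induction A rule: infinite_finite_induct) (auto simp: of_rat_add)

lemma of_rat_prod: "(of_rat (\<Prod>i\<in>A. f i) :: 'k::field_char_0) = (\<Prod>i\<in>A. of_rat (f i))"
  by (induction A rule: infinite_finite_induct) (auto simp: of_rat_mult)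

lemma emb_mult: "emb (A ** B) = emb A ** emb B"
  by (simp add: emb_def matrix_matrix_mult_def vec_eq_iff of_rat_sum of_rat_mult)

lemma emb_mat_1 [simp]: "emb (mat 1) = mat 1"
  by (simp add: emb_def mat_def vec_eq_iff)

lemma emb_0 [simp]: "emb 0 = 0"
  by (simp add: emb_def vec_eq_iff)

lemma emb_add: "emb (A + B) = emb A + emb B"
  by (simp add: emb_def vec_eq_iff of_rat_add)

lemma emb_matrix_scale: "emb (matrix_scale c A) = matrix_scale (of_rat c) (emb A)"
  by (simp add: emb_def matrix_scale_def vec_eq_iff of_rat_mult)

lemma emb_sum: "emb (\<Sum>i\<in>A. f i) = (\<Sum>i\<in>A. emb (f i))"
  by (induction A rule: infinite_finite_induct) (auto simp: emb_add)

lemma emb_eq_iff [simp]: "emb A = emb B \<longleftrightarrow> A = B"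
  by (auto simp: emb_def vec_eq_iff)

lemma det_emb: "det (emb A) = of_rat (det A)"
  by (simp add: det_def emb_def of_rat_sum of_rat_mult of_rat_prod)

lemma trace_emb: "trace (emb A) = of_rat (trace A)"
  by (simp add: trace_def emb_def of_rat_sum)

lemma matrix_pow_Suc: "matrix_pow A (Suc i) = A ** matrix_pow A i"
  by (simp add: matrix_pow_def)

lemma matrix_pow_0 [simp]: "matrix_pow A 0 = mat 1"
  by (simp add: matrix_pow_def)

lemma emb_matrix_pow: "emb (matrix_pow A i) = matrix_pow (emb A) i"
  by (induction i) (simp_all add: matrix_pow_Suc emb_mult)

section \<open>Descent of polynomial functions and tangent vectors to the rationals\<close>

lemma matpolyfun_rat_linear:
  fixes F :: "'k::field_char_0^'n^'n \<Rightarrow> 'k"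
  assumes "matpolyfun F" "rat_linear \<phi>"
  shows "matpolyfun (\<lambda>g. \<phi> (F (emb g)))"
proof -
  obtain N :: nat and c m where F: "\<And>x. F (mat_of x) = (\<Sum>i<N. c i * (\<Prod>v\<in>UNIV. x v ^ m i v))"
    using polyfun_normal_form[of UNIV "\<lambda>x. F (mat_of x)"] assms(1) by (auto simp: matpolyfun_def)
  have "emb (mat_of x) = (mat_of (\<lambda>v. of_rat (x v)) :: 'k^'n^'n)" for x :: "'n \<times> 'n \<Rightarrow> rat"
    by (simp add: emb_def mat_of_def vec_eq_iff)
  moreover have "\<phi> (c i * (\<Prod>v\<in>UNIV. of_rat (x v) ^ m i v)) = (\<Prod>v\<in>UNIV. x v ^ m i v) * \<phi> (c i)" for i x
    using rat_linear_scale[OF assms(2), of "\<Prod>v\<in>UNIV. x v ^ m i v" "c i"]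
    by (simp add: of_rat_prod of_rat_power mult.commute)
  ultimately have "\<phi> (F (emb (mat_of x))) = (\<Sum>i<N. (\<Prod>v\<in>UNIV. x v ^ m i v) * \<phi> (c i))" for x
    by (simp add: F rat_linear_sum[OF assms(2)])
  then show ?thesis
    unfolding matpolyfun_def
    by (auto intro!: polyfun_sum polyfun_mult polyfun_prod polyfun_power polyfun_var polyfun.const)
qed

lemma matpolyfun_lift:
  assumes "matpolyfun (f :: rat^'n^'n \<Rightarrow> rat)"
  shows "\<exists>F :: 'k::field_char_0^'n^'n \<Rightarrow> 'k. matpolyfun F \<and> (\<forall>g. F (emb g) = of_rat (f g))"
proof -
  obtain N :: nat and c m where f: "\<And>x. f (mat_of x) = (\<Sum>i<N. c i * (\<Prod>v\<in>UNIV. x v ^ m i v))"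
    using polyfun_normal_form[of UNIV "\<lambda>x. f (mat_of x)"] assms by (auto simp: matpolyfun_def)
  define F :: "'k^'n^'n \<Rightarrow> 'k"
    where "F g = (\<Sum>i<N. of_rat (c i) * (\<Prod>v\<in>UNIV. (g $ fst v $ snd v) ^ m i v))" for g
  have "matpolyfun F"
    unfolding F_def by (intro matpolyfun_sum matpolyfun_mult matpolyfun_prod matpolyfun_power
        matpolyfun_entry matpolyfun_const)
  moreover have "F (emb g) = of_rat (f g)" for g
  proof -
    have "mat_of (\<lambda>v. g $ fst v $ snd v) = g"
      by (simp add: mat_of_def vec_eq_iff)
    then show ?thesis
      using f[of "\<lambda>v. g $ fst v $ snd v"]
      by (simp add: F_def emb_def of_rat_sum of_rat_mult of_rat_prod of_rat_power)
  qed
  ultimately show ?thesis by blast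
qed

text \<open>For rational \<open>s\<close> the functional acts on the polynomial along the line
  coefficient by coefficient.\<close>

lemma has_dir_deriv_rat_linear:
  fixes F :: "'k::field_char_0^'n^'n \<Rightarrow> 'k"
  assumes "has_dir_deriv F (emb g) (emb B) d" "rat_linear \<phi>"
  shows "has_dir_deriv (\<lambda>g. \<phi> (F (emb g))) g B (\<phi> d)"
proof -
  obtain h where h: "\<And>s. F (emb g + matrix_scale s (emb B)) = poly h s" "coeff h 1 = d"
    using assms(1) by (auto simp: has_dir_deriv_def)
  have "\<phi> (F (emb (g + matrix_scale s B))) = poly (map_poly \<phi> h) s" for s
  proof -
    have "\<phi> (F (emb (g + matrix_scale s B))) = (\<Sum>i\<le>degree h. \<phi> (of_rat (s ^ i) * coeff h i))"
      by (simp add: emb_add emb_matrix_scale h poly_altdef rat_linear_sum[OF assms(2)]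
          of_rat_power mult.commute)
    also have "\<dots> = (\<Sum>i\<le>degree h. coeff (map_poly \<phi> h) i * s ^ i)"
      by (simp add: rat_linear_scale[OF assms(2)] coeff_map_poly rat_linear_0[OF assms(2)])
        (simp add: mult.commute)
    also have "\<dots> = poly (map_poly \<phi> h) s"
      unfolding poly_altdef
      by (intro sum.mono_neutral_right) (auto simp: coeff_eq_0 intro: le_trans[OF map_poly_degree_leq])
    finally show ?thesis .
  qed
  then show ?thesis
    using h(2) by (auto simp: has_dir_deriv_def coeff_map_poly rat_linear_0[OF assms(2)])
qed

lemma has_dir_deriv_exists:
  fixes F :: "'a::field_char_0^'n^'n \<Rightarrow> 'a"
  shows "matpolyfun F \<Longrightarrow> \<exists>d. has_dir_deriv F g B d"
  using matpolyfun_has_dir_deriv by metis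

lemma has_dir_deriv_lift:
  fixes F :: "'k::field_char_0^'n^'n \<Rightarrow> 'k"
  assumes f: "matpolyfun f" and F: "\<And>g. F (emb g) = of_rat (f g)"
    and d: "has_dir_deriv F (emb g) (emb B) (of_rat d)"
  shows "has_dir_deriv f g B d"
proof -
  obtain \<phi> :: "'k \<Rightarrow> rat" where \<phi>: "rat_linear \<phi>" "\<And>r. \<phi> (of_rat r) = r"
    using rat_linear_retraction by blast
  from has_dir_deriv_rat_linear[OF d \<phi>(1)] show ?thesis by (simp add: F \<phi>(2))
qed

text \<open>Every functional turns \<open>F\<close> into a rational polynomial function vanishing on
  \<open>G\<close>, hence kills the derivative of \<open>F\<close>; the functionals together detect
  0. With \<open>Lie_of_subsetI\<close>, membership in the Lie algebra may be tested over the larger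
  field.\<close>

lemma Lie_of_emb:
  fixes F :: "'k::field_char_0^'n^'n \<Rightarrow> 'k"
  assumes "A \<in> Lie_of G" "matpolyfun F" "\<And>g. g \<in> G \<Longrightarrow> F (emb g) = 0"
  shows "has_dir_deriv F (mat 1) (emb A) 0"
proof -
  obtain d where d: "has_dir_deriv F (emb (mat 1)) (emb A) d"
    using has_dir_deriv_exists[OF assms(2)] by blast
  have "\<phi> d = 0" if \<phi>: "rat_linear \<phi>" for \<phi>
  proof -
    have "has_dir_deriv (\<lambda>g. \<phi> (F (emb g))) (mat 1) A 0"
      using assms(1) matpolyfun_rat_linear[OF assms(2) \<phi>] assms(3) rat_linear_0[OF \<phi>]
      unfolding Lie_of_iff by auto
    with has_dir_deriv_rat_linear[OF d \<phi>] show ?thesis using has_dir_deriv_unique by blast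
  qed
  then have "d = 0" by (rule rat_linear_separates)
  with d show ?thesis by simp
qed

lemma Lie_of_subsetI:
  fixes A :: "rat^'n^'n"
  assumes "\<And>F :: 'k::field_char_0^'n^'n \<Rightarrow> 'k. matpolyfun F \<Longrightarrow> (\<And>g. g \<in> G \<Longrightarrow> F (emb g) = 0) \<Longrightarrow>
    has_dir_deriv F (mat 1) (emb A) 0"
  shows "A \<in> Lie_of G"
  unfolding Lie_of_iff
proof safe
  fix f :: "rat^'n^'n \<Rightarrow> rat" assume f: "matpolyfun f" "\<forall>g\<in>G. f g = 0"
  obtain F :: "'k^'n^'n \<Rightarrow> 'k" where F: "matpolyfun F" "\<And>g. F (emb g) = of_rat (f g)"
    using matpolyfun_lift[OF f(1), where 'k='k] by blast
  have "has_dir_deriv F (emb (mat 1)) (emb A) (of_rat 0)"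
    using assms[OF F(1)] F(2) f(2) by simp
  then show "has_dir_deriv f (mat 1) A 0"
    using has_dir_deriv_lift[OF f(1) F(2)] by blast
qed

text \<open>Equations over the larger field may be used: if \<open>F\<close> is nonzero at a point,
  some functional applied to \<open>F\<close> is a rational polynomial that is still nonzero
  there.\<close>

lemma zero_set_emb:
  fixes G :: "(rat^'n^'n) set"
  assumes "\<And>g. g \<in> G \<Longrightarrow> invertible g"
    and "\<And>g. invertible g \<Longrightarrow> g \<notin> G \<Longrightarrow> \<exists>F :: 'k::field_char_0^'n^'n \<Rightarrow> 'k. matpolyfun F \<and>
           (\<forall>h\<in>G. F (emb h) = 0) \<and> F (emb g) \<noteq> 0"
  shows "\<exists>P. G = {g. invertible g \<and> (\<forall>p\<in>P. coord_eval p g = 0)}"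
proof (intro exI[of _ "{p. \<forall>h\<in>G. coord_eval p h = 0}"] equalityI subsetI CollectI)
  fix g assume g: "g \<in> {g. invertible g \<and> (\<forall>p\<in>{p. \<forall>h\<in>G. coord_eval p h = 0}. coord_eval p g = 0)}"
  show "g \<in> G"
  proof (rule ccontr)
    assume "g \<notin> G"
    then obtain F :: "'k^'n^'n \<Rightarrow> 'k" where F: "matpolyfun F" "\<forall>h\<in>G. F (emb h) = 0" "F (emb g) \<noteq> 0"
      using assms(2) g by blast
    then obtain \<phi> where \<phi>: "rat_linear \<phi>" "\<phi> (F (emb g)) \<noteq> 0"
      using rat_linear_separates by blast
    obtain p where p: "\<And>g. \<phi> (F (emb g)) = coord_eval p g"
      using matpolyfun_imp_coord_eval[OF matpolyfun_rat_linear[OF F(1) \<phi>(1)]] by blast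
    have "\<forall>h\<in>G. coord_eval p h = 0"
      using F(2) rat_linear_0[OF \<phi>(1)] by (simp flip: p)
    then have "coord_eval p g = 0" using g by blast
    then show False using \<phi>(2) p by simp
  qed
qed (use assms(1) in auto)

section \<open>Diagonalised rational matrices\<close>

definition diag_mat :: "('n \<Rightarrow> 'a::zero) \<Rightarrow> 'a^'n^'n" where
  "diag_mat z = (\<chi> i j. if i = j then z i else 0)"

lemma diag_mat_mult: "diag_mat z ** diag_mat w = diag_mat (\<lambda>k. z k * (w k :: 'a::comm_ring_1))"
  by (auto simp: diag_mat_def matrix_matrix_mult_def vec_eq_iff if_distrib[of "\<lambda>x. x * _"]
      if_distrib[of "\<lambda>x. _ * x"] sum.delta cong: if_cong)

lemma diag_mat_1: "diag_mat (\<lambda>_. 1) = mat 1"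
  by (simp add: diag_mat_def mat_def)

locale diagonalised_matrix =
  fixes X :: "rat^'n^'n" and \<alpha> :: "'n \<Rightarrow> 'k::field_char_0" and P Q :: "'k^'n^'n"
  assumes inj_\<alpha>: "inj \<alpha>" and PQ: "P ** Q = mat 1" and QP: "Q ** P = mat 1"
    and emb_X_eq: "emb X = P ** diag_mat \<alpha> ** Q"
begin

definition D :: "('n \<Rightarrow> 'k) \<Rightarrow> 'k^'n^'n" where
  "D z = P ** diag_mat z ** Q"

lemma emb_X: "emb X = D \<alpha>"
  by (simp add: D_def emb_X_eq)

lemma D_mult: "D z ** D w = D (\<lambda>k. z k * w k)"
proof -
  have "D z ** D w = P ** diag_mat z ** (Q ** P) ** diag_mat w ** Q"
    by (simp add: D_def matrix_mul_assoc)
  then show ?thesis by (simp add: QP D_def diag_mat_mult flip: matrix_mul_assoc)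
qed

lemma D_1: "D (\<lambda>_. 1) = mat 1"
  by (simp add: D_def diag_mat_1 PQ)

lemma D_entry: "D z $ i $ j = (\<Sum>k\<in>UNIV. P $ i $ k * z k * Q $ k $ j)"
  by (simp add: D_def diag_mat_def matrix_matrix_mult_def if_distrib[of "\<lambda>x. _ * x"] sum.delta
      cong: if_cong)

lemma D_add_scale: "D z + matrix_scale s (D w) = D (\<lambda>k. z k + s * w k)"
  by (simp add: vec_eq_iff D_entry matrix_scale_def sum_distrib_left sum.distrib[symmetric]
      algebra_simps)

lemma D_0: "D (\<lambda>_. 0) = 0"
  by (simp add: vec_eq_iff D_entry)

lemma D_sum: "D (\<lambda>k. \<Sum>i\<in>A. f i k) = (\<Sum>i\<in>A. D (f i))"
proof (induction A rule: infinite_finite_induct)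
  case (insert a A)
  then show ?case using D_add_scale[of "f a" 1 "\<lambda>k. \<Sum>i\<in>A. f i k"]
    by (simp add: matrix_scale_def vec_eq_iff)
qed (simp_all add: D_0)

lemma D_scale: "D (\<lambda>k. s * w k) = matrix_scale s (D w)"
  using D_add_scale[of "\<lambda>_. 0" s w] by (simp add: D_0)

lemma matrix_pow_D: "matrix_pow (D z) i = D (\<lambda>k. z k ^ i)"
  by (induction i) (simp_all add: matrix_pow_Suc D_1 D_mult)

lemma QDP: "Q ** D z ** P = diag_mat z"
proof -
  have "Q ** D z ** P = (Q ** P) ** diag_mat z ** (Q ** P)"
    by (simp add: D_def matrix_mul_assoc)
  then show ?thesis by (simp add: QP)
qed

lemma D_eq_iff: "D z = D w \<longleftrightarrow> z = w"
proof
  assume "D z = D w"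
  then have "diag_mat z = diag_mat w" using QDP by metis
  then show "z = w" by (simp add: diag_mat_def vec_eq_iff fun_eq_iff) metis
qed simp

lemma trace_D: "trace (D z) = (\<Sum>k\<in>UNIV. z k)"
proof -
  have "trace (D z) = trace (Q ** (P ** diag_mat z))"
    unfolding D_def by (rule trace_mul_sym)
  also have "\<dots> = trace (diag_mat z)" by (simp add: matrix_mul_assoc QP)
  finally show ?thesis by (simp add: trace_def diag_mat_def)
qed

lemma power_sum: "(\<Sum>k\<in>UNIV. \<alpha> k ^ m) = of_rat (trace (matrix_pow X m))"
  by (simp flip: trace_D trace_emb add: emb_matrix_pow emb_X matrix_pow_D)

sublocale rational_roots \<alpha>
  by unfold_locales (simp_all add: inj_\<alpha> power_sum)

text \<open>Polynomial in the entries and defined for every matrix; for matrices commuting with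
  \<open>X\<close> these are the eigenvalues, listed in the order of \<open>\<alpha>\<close>
  (\<open>emb_commuting\<close>).\<close>

definition eig :: "rat^'n^'n \<Rightarrow> 'n \<Rightarrow> 'k" where
  "eig g k = (Q ** emb g ** P) $ k $ k"

lemma eig_eqI: "emb g = D z \<Longrightarrow> eig g = z"
  by (simp add: eig_def fun_eq_iff QDP) (simp add: diag_mat_def)

text \<open>In the eigenbasis, commuting forces (\<alpha>_i - \<alpha>_j) B_ij = 0, and the roots
  are distinct.\<close>

lemma commutes_imp_D:
  assumes "A ** D \<alpha> = D \<alpha> ** A"
  shows "\<exists>z. A = D z"
proof -
  define B where "B = Q ** A ** P"
  have A: "A = P ** B ** Q"
  proof -
    have "P ** B ** Q = (P ** Q) ** A ** (P ** Q)" by (simp add: B_def matrix_mul_assoc)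
    then show ?thesis by (simp add: PQ)
  qed
  have "B ** diag_mat \<alpha> = Q ** (A ** D \<alpha>) ** P"
  proof -
    have "Q ** (A ** D \<alpha>) ** P = B ** diag_mat \<alpha> ** (Q ** P)"
      by (simp add: B_def D_def matrix_mul_assoc)
    then show ?thesis by (simp add: QP)
  qed
  also have "\<dots> = diag_mat \<alpha> ** B"
  proof -
    have "Q ** (D \<alpha> ** A) ** P = (Q ** P) ** diag_mat \<alpha> ** B"
      by (simp add: B_def D_def matrix_mul_assoc)
    then show ?thesis by (simp add: QP assms)
  qed
  finally have eq: "B ** diag_mat \<alpha> = diag_mat \<alpha> ** B" .
  have "B $ i $ j * \<alpha> j = \<alpha> i * B $ i $ j" for i j
  proof -
    have "(B ** diag_mat \<alpha>) $ i $ j = B $ i $ j * \<alpha> j"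
      by (simp add: matrix_matrix_mult_def diag_mat_def if_distrib[of "\<lambda>x. _ * x"] sum.delta cong: if_cong)
    moreover have "(diag_mat \<alpha> ** B) $ i $ j = \<alpha> i * B $ i $ j"
      by (simp add: matrix_matrix_mult_def diag_mat_def if_distrib[of "\<lambda>x. x * _"] sum.delta cong: if_cong)
    ultimately show ?thesis using eq by metis
  qed
  then have "B $ i $ j = 0" if "i \<noteq> j" for i j
    using that inj_\<alpha> by (metis injD mult.commute mult_cancel_left)
  then have "B = diag_mat (\<lambda>k. B $ k $ k)"
    by (simp add: diag_mat_def vec_eq_iff)
  then show ?thesis using A unfolding D_def by metis
qed

lemma emb_commuting: "g ** X = X ** g \<Longrightarrow> emb g = D (eig g)"
  using commutes_imp_D[of "emb g"] eig_eqI by (metis emb_X emb_mult)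

lemma emb_D_commuting: "emb g = D z \<Longrightarrow> g ** X = X ** g"
proof -
  assume "emb g = D z"
  then have "emb (g ** X) = (emb (X ** g) :: 'k^'n^'n)"
    by (simp add: emb_mult emb_X D_mult mult.commute)
  then show ?thesis by simp
qed

definition matrix_of_coeffs :: "(nat \<Rightarrow> rat) \<Rightarrow> rat^'n^'n" where
  "matrix_of_coeffs u = (\<Sum>i<CARD('n). matrix_scale (u i) (matrix_pow X i))"

lemma emb_matrix_of_coeffs:
  "emb (matrix_of_coeffs u) = D (\<lambda>k. \<Sum>i<CARD('n). of_rat (u i) * \<alpha> k ^ i)"
  by (simp add: matrix_of_coeffs_def emb_sum emb_matrix_scale emb_matrix_pow emb_X matrix_pow_D
      D_sum D_scale)

text \<open>Interpolate \<open>z\<close> by a polynomial in the roots and apply a Q-linear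
  retraction onto the rationals to its coefficients. The moments depend on the coefficients through
  a rational matrix and are themselves rational, so they do not change; equal moments at distinct
  roots force equal values.\<close>

lemma rational_spectrum:
  assumes "\<And>i. (\<Sum>k\<in>UNIV. \<alpha> k ^ i * z k) \<in> \<rat>"
  shows "\<exists>u. emb (matrix_of_coeffs u) = D z"
proof -
  obtain \<phi> :: "'k \<Rightarrow> rat" where \<phi>: "rat_linear \<phi>" "\<And>r. \<phi> (of_rat r) = r"
    using rat_linear_retraction by blast
  obtain h where h: "\<And>a. a \<in> range \<alpha> \<Longrightarrow> poly h a = z (inv \<alpha> a)" "\<And>i. i \<ge> CARD('n) \<Longrightarrow> coeff h i = 0"
    using interpolation_exists[of "range \<alpha>" "\<lambda>a. z (inv \<alpha> a)"] card_image[OF inj_\<alpha>] by auto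
  define n where "n = CARD('n)"
  have z: "z k = (\<Sum>r<n. coeff h r * \<alpha> k ^ r)" for k
  proof -
    have "z k = poly h (\<alpha> k)" using h(1)[of "\<alpha> k"] by (simp add: inj_\<alpha>)
    also have "\<dots> = (\<Sum>r\<in>{..degree h} \<union> {..<n}. coeff h r * \<alpha> k ^ r)"
      unfolding poly_altdef by (intro sum.mono_neutral_left) (auto simp: coeff_eq_0)
    also have "\<dots> = (\<Sum>r<n. coeff h r * \<alpha> k ^ r)"
      using h(2) by (intro sum.mono_neutral_right) (auto simp: n_def not_less)
    finally show ?thesis .
  qed
  define w where "w k = (\<Sum>r<n. of_rat (\<phi> (coeff h r)) * \<alpha> k ^ r)" for k
  let ?p = "\<lambda>m. trace (matrix_pow X m)"
  \<comment> \<open>The matrix from coefficients to moments is the Hankel matrix of power sums,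
    rational because these are traces.\<close>
  have sw: "(\<Sum>k\<in>UNIV. \<alpha> k ^ i * (\<Sum>r<n. c r * \<alpha> k ^ r)) = (\<Sum>r<n. of_rat (?p (i + r)) * c r)" for i c
    unfolding power_sum[symmetric] sum_distrib_left sum_distrib_right
    by (subst sum.swap) (simp add: power_add ac_simps)
  have "(\<Sum>k\<in>UNIV. (z k - w k) * \<alpha> k ^ i) = 0" for i
  proof -
    obtain t where t: "(\<Sum>k\<in>UNIV. \<alpha> k ^ i * z k) = of_rat t"
      using assms[of i] by (auto elim: Rats_cases)
    have "of_rat t = (\<Sum>r<n. of_rat (?p (i + r)) * coeff h r)"
      unfolding t[symmetric] by (subst sw[symmetric]) (simp flip: z)
    then have "\<phi> (of_rat t) = \<phi> (\<Sum>r<n. of_rat (?p (i + r)) * coeff h r)" by simp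
    then have "t = (\<Sum>r<n. ?p (i + r) * \<phi> (coeff h r))"
      by (simp add: \<phi>(2) rat_linear_sum[OF \<phi>(1)] rat_linear_scale[OF \<phi>(1)])
    then have "of_rat t = (\<Sum>r<n. of_rat (?p (i + r)) * of_rat (\<phi> (coeff h r)))"
      by (simp add: of_rat_sum of_rat_mult)
    also have "\<dots> = (\<Sum>k\<in>UNIV. \<alpha> k ^ i * w k)"
      unfolding w_def by (rule sw[symmetric])
    finally show ?thesis
      using t by (simp add: algebra_simps sum_subtractf)
  qed
  \<comment> \<open>The weight is the indicator of the index \<open>j\<close>; distinct roots make
    it a function of the node.\<close>
  then have "(\<Sum>k\<in>UNIV. (z k - w k) * (if k = j then 1 else 0)) = 0" for j
    by (rule power_moments_vanish[OF finite]) (use inj_\<alpha> in \<open>auto simp: inj_eq\<close>)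
  then have "z = w" by (simp add: if_distrib[of "\<lambda>x. _ * x"] sum.delta fun_eq_iff cong: if_cong)
  then show ?thesis
    by (intro exI[of _ "\<lambda>r. \<phi> (coeff h r)"]) (simp add: emb_matrix_of_coeffs w_def[abs_def] n_def)
qed

text \<open>The required moments of the eigenvalues of \<open>g\<close> are traces of X^i g, hence
  rational.\<close>

lemma commuting_imp_polynomial:
  assumes "g ** X = X ** g"
  shows "\<exists>u. g = matrix_of_coeffs u"
proof -
  have "(\<Sum>k\<in>UNIV. \<alpha> k ^ i * eig g k) = of_rat (trace (matrix_pow X i ** g))" for i
    using emb_commuting[OF assms]
    by (simp flip: trace_D trace_emb D_mult matrix_pow_D add: emb_mult emb_matrix_pow emb_X)
  then obtain u where "emb (matrix_of_coeffs u) = D (eig g)"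
    using rational_spectrum[of "eig g"] by auto
  then show ?thesis using emb_commuting[OF assms] by (metis emb_eq_iff)
qed

end

section \<open>The algebraic hull\<close>

lemma matrix_inv_works:
  assumes "invertible (g :: 'a::field^'n^'n)"
  shows "g ** matrix_inv g = mat 1" "matrix_inv g ** g = mat 1"
  using someI_ex[OF assms[unfolded invertible_def]] by (auto simp: matrix_inv_def)

context diagonalised_matrix
begin

section \<open>The torus of the multiplicative relations and its Lie algebra\<close>

definition alg_hull :: "(rat^'n^'n) set" where
  "alg_hull = {A. A ** X = X ** A \<and> (\<forall>e. lin_rel e \<longrightarrow> (\<Sum>k\<in>UNIV. of_int (e k) * eig A k) = 0)}"

text \<open>Exponents are split into positive and negative parts to stay polynomial. For invertible
  \<open>g\<close> the eigenvalues are nonzero, so this says that the product of the powers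
  \<open>e k\<close> is 1.\<close>

definition torus :: "(rat^'n^'n) set" where
  "torus = {g. invertible g \<and> g ** X = X ** g \<and>
     (\<forall>e. lin_rel e \<longrightarrow> (\<Prod>k\<in>UNIV. eig g k ^ nat (e k)) = (\<Prod>k\<in>UNIV. eig g k ^ nat (- e k)))}"

lemma eig_mat_1: "eig (mat 1) = (\<lambda>_. 1)"
  by (rule eig_eqI) (simp add: D_1)

lemma eig_mult:
  assumes "g ** X = X ** g" "h ** X = X ** h"
  shows "eig (g ** h) = (\<lambda>k. eig g k * eig h k)"
  by (rule eig_eqI) (simp add: emb_mult emb_commuting[OF assms(1)] emb_commuting[OF assms(2)] D_mult)

lemma commutes_matrix_inv:
  assumes "invertible g" "g ** X = X ** g"
  shows "matrix_inv g ** X = X ** matrix_inv g"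
proof -
  let ?i = "matrix_inv g"
  have "?i ** X = ?i ** X ** (g ** ?i)" by (simp add: matrix_inv_works[OF assms(1)])
  also have "\<dots> = ?i ** (X ** g) ** ?i" by (simp add: matrix_mul_assoc)
  also have "\<dots> = (?i ** g) ** X ** ?i" by (simp add: assms(2)[symmetric] matrix_mul_assoc)
  finally show ?thesis by (simp add: matrix_inv_works[OF assms(1)])
qed

lemma eig_matrix_inv:
  assumes "invertible g" "g ** X = X ** g"
  shows "eig g k * eig (matrix_inv g) k = 1"
  using eig_mult[OF assms(2) commutes_matrix_inv[OF assms]] eig_mat_1
  by (simp add: matrix_inv_works[OF assms(1)] fun_eq_iff)

lemma mat_1_torus: "mat 1 \<in> torus"
  by (simp add: torus_def eig_mat_1 invertible_def exI[of _ "mat 1"])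

lemma mult_torus:
  assumes "g \<in> torus" "h \<in> torus"
  shows "g ** h \<in> torus"
proof -
  have c: "g ** X = X ** g" "h ** X = X ** h" using assms by (auto simp: torus_def)
  have "g ** h ** X = g ** (X ** h)" by (simp add: c(2) flip: matrix_mul_assoc)
  also have "\<dots> = X ** (g ** h)" by (simp add: matrix_mul_assoc c(1))
  finally show ?thesis
    using assms by (auto simp: torus_def eig_mult[OF c] power_mult_distrib prod.distrib
        intro: invertible_mult)
qed

lemma inv_torus:
  assumes "g \<in> torus"
  shows "matrix_inv g \<in> torus"
proof -
  have g: "invertible g" "g ** X = X ** g" using assms by (auto simp: torus_def)
  have e: "eig (matrix_inv g) k = inverse (eig g k)" for k
    using eig_matrix_inv[OF g, of k] by (metis inverse_unique)
  have "invertible (matrix_inv g)"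
    using matrix_inv_works[OF g(1)] unfolding invertible_def by blast
  moreover have "(\<Prod>k\<in>UNIV. inverse (eig g k) ^ m k) = inverse (\<Prod>k\<in>UNIV. eig g k ^ m k)" for m :: "'n \<Rightarrow> nat"
    by (simp add: power_inverse prod_inversef[symmetric] comp_def)
  ultimately show ?thesis
    using assms commutes_matrix_inv[OF g] by (auto simp: torus_def e)
qed

lemma matpolyfun_conj_entry: "matpolyfun (\<lambda>A. (Q ** A ** P) $ k $ k)"
  by (rule matpolyfun_entry_mult)

lemma matpolyfun_commutator: "matpolyfun (\<lambda>A. (A ** emb X - emb X ** A) $ i $ j)"
  using matpolyfun_diff[OF matpolyfun_entry_mult[of "mat 1" "emb X" i j] matpolyfun_entry_mult[of "emb X" "mat 1" i j]]
  by simp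

definition rel_poly :: "('n \<Rightarrow> int) \<Rightarrow> 'k^'n^'n \<Rightarrow> 'k" where
  "rel_poly e A = (\<Prod>k\<in>UNIV. ((Q ** A ** P) $ k $ k) ^ nat (e k)) - (\<Prod>k\<in>UNIV. ((Q ** A ** P) $ k $ k) ^ nat (- e k))"

lemma matpolyfun_rel_poly: "matpolyfun (rel_poly e)"
  unfolding rel_poly_def[abs_def]
  by (intro matpolyfun_diff matpolyfun_prod matpolyfun_power matpolyfun_conj_entry)

text \<open>The natural equations involve \<open>P\<close> and \<open>Q\<close>, so their
  coefficients lie in \<open>'k\<close>; \<open>zero_set_emb\<close> replaces them by rational
  ones.\<close>

lemma algebraic_subgroup_torus: "algebraic_subgroup torus"
proof -
  have "\<exists>P. torus = {g. invertible g \<and> (\<forall>p\<in>P. coord_eval p g = 0)}"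
  proof (rule zero_set_emb)
    fix g assume g: "invertible g" "g \<notin> torus"
    show "\<exists>F :: 'k^'n^'n \<Rightarrow> 'k. matpolyfun F \<and> (\<forall>h\<in>torus. F (emb h) = 0) \<and> F (emb g) \<noteq> 0"
    proof (cases "g ** X = X ** g")
      case False
      then have "(emb g ** emb X :: 'k^'n^'n) \<noteq> emb X ** emb g" by (simp flip: emb_mult)
      then obtain i j where "(emb g ** emb X - emb X ** emb g :: 'k^'n^'n) $ i $ j \<noteq> 0"
        by (auto simp: vec_eq_iff)
      moreover have "(emb h ** emb X - emb X ** emb h :: 'k^'n^'n) $ i $ j = 0" if "h \<in> torus" for h
        using that by (simp add: torus_def flip: emb_mult)
      ultimately show ?thesis using matpolyfun_commutator[of i j] by blast
    next
      case True
      then obtain e where "lin_rel e" "rel_poly e (emb g) \<noteq> 0"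
        using g by (auto simp: torus_def rel_poly_def eig_def)
      moreover have "rel_poly e (emb h) = 0" if "h \<in> torus" for h
        using that \<open>lin_rel e\<close> by (simp add: torus_def rel_poly_def eig_def)
      ultimately show ?thesis using matpolyfun_rel_poly by blast
    qed
  qed (simp add: torus_def)
  then show ?thesis
    using mat_1_torus mult_torus inv_torus by (auto simp: algebraic_subgroup_def)
qed

lemma polynomial_on_torus:
  assumes "matpolyfun F"
  shows "\<exists>(N::nat) c m. \<forall>z. F (D z) = (\<Sum>i<N. c i * (\<Prod>k\<in>UNIV. z k ^ m i k))"
proof -
  have "polyfun UNIV (\<lambda>z. (\<lambda>x. F (mat_of x)) (\<lambda>v. D z $ fst v $ snd v))"
    using assms unfolding D_entry
    by (intro polyfun_subst[where F = "\<lambda>x. F (mat_of x)" and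
          G = "\<lambda>v z. \<Sum>k\<in>UNIV. P $ fst v $ k * z k * Q $ k $ snd v"]
        polyfun_sum polyfun_mult polyfun_var polyfun.const) (simp_all add: matpolyfun_def)
  moreover have "mat_of (\<lambda>v. D z $ fst v $ snd v) = D z" for z
    by (simp add: mat_of_def vec_eq_iff)
  ultimately have "polyfun UNIV (\<lambda>z. F (D z))" by simp
  then show ?thesis using polyfun_normal_form[of UNIV "\<lambda>z. F (D z)"] by auto
qed

text \<open>In the invariant direction z_k a_k each coordinate becomes z_k (1 + s a_k), so every
  monomial z^m is an eigenvector of the derivation, with eigenvalue m.a.\<close>

lemma has_dir_deriv_torus:
  fixes N :: nat
  assumes F: "\<And>z. F (D z) = (\<Sum>i<N. c i * (\<Prod>k\<in>UNIV. z k ^ m i k))"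
  shows "has_dir_deriv F (D z) (D (\<lambda>k. z k * a k))
    (\<Sum>i<N. c i * (\<Sum>k\<in>UNIV. of_nat (m i k) * a k) * (\<Prod>k\<in>UNIV. z k ^ m i k))"
proof -
  define h where "h = (\<Sum>i<N. smult (c i * (\<Prod>k\<in>UNIV. z k ^ m i k)) (\<Prod>k\<in>UNIV. [:1, a k:] ^ m i k))"
  have "F (D z + matrix_scale s (D (\<lambda>k. z k * a k))) = poly h s" for s
  proof -
    have "z k + s * (z k * a k) = z k * (1 + s * a k)" for k by (simp add: algebra_simps)
    then show ?thesis
      by (simp add: D_add_scale F h_def poly_sum poly_prod power_mult_distrib prod.distrib mult.assoc)
  qed
  moreover have "coeff h 1 = (\<Sum>i<N. c i * (\<Sum>k\<in>UNIV. of_nat (m i k) * a k) * (\<Prod>k\<in>UNIV. z k ^ m i k))"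
    unfolding h_def coeff_sum coeff_smult coeff_1_prod_linear_powers by (simp add: ac_simps)
  ultimately show ?thesis unfolding has_dir_deriv_def by blast
qed

lemma hull_exponents:
  assumes "A \<in> alg_hull" "lin_rel (\<lambda>k. int (m k) - int (m' k))"
  shows "(\<Sum>k\<in>UNIV. of_nat (m k) * eig A k) = (\<Sum>k\<in>UNIV. of_nat (m' k) * eig A k)"
  using assms by (auto simp: alg_hull_def left_diff_distrib sum_subtractf)

text \<open>For each \<open>F\<close> a single rational point suffices: \<open>F\<close> vanishes at
  all its powers, which says that the moments of the coefficients at the nodes y^m vanish, and the
  derivative of \<open>F\<close> along \<open>A\<close> is the sum against a function of these
  nodes.\<close>

lemma hull_subset_Lie_of_torus: "alg_hull \<subseteq> Lie_of torus"
proof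
  fix A assume A: "A \<in> alg_hull"
  then have embA: "emb A = D (eig A)" by (simp add: alg_hull_def emb_commuting)
  show "A \<in> Lie_of torus"
  proof (rule Lie_of_subsetI)
    fix F :: "'k^'n^'n \<Rightarrow> 'k" assume F: "matpolyfun F" and F0: "\<And>g. g \<in> torus \<Longrightarrow> F (emb g) = 0"
    obtain N :: nat and c m where cm: "\<And>z. F (D z) = (\<Sum>i<N. c i * (\<Prod>k\<in>UNIV. z k ^ m i k))"
      using polynomial_on_torus[OF F] by blast
    obtain y where y: "\<And>j. y j \<noteq> 0" "\<And>i. (\<Sum>j\<in>UNIV. \<alpha> j ^ i * y j) \<in> \<rat>"
      "\<And>e. lin_rel e \<Longrightarrow> (\<Prod>j\<in>UNIV. y j ^ nat (e j)) = (\<Prod>j\<in>UNIV. y j ^ nat (- e j))"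
      "\<And>p p'. p \<in> m ` {..<N} \<Longrightarrow> p' \<in> m ` {..<N} \<Longrightarrow>
         (\<Prod>j\<in>UNIV. y j ^ p j) = (\<Prod>j\<in>UNIV. y j ^ p' j) \<Longrightarrow> lin_rel (\<lambda>j. int (p j) - int (p' j))"
      using separating_torus_point[of "m ` {..<N}", OF finite_imageI[OF finite_lessThan]] by blast
    obtain u where u: "emb (matrix_of_coeffs u) = D y"
      using rational_spectrum[OF y(2)] by blast
    define g where "g = matrix_of_coeffs u"
    have g: "emb g = D y" by (simp add: g_def u)
    have "D y ** D (\<lambda>k. inverse (y k)) = mat 1" by (simp add: D_mult y(1) D_1)
    then have "det (D y) \<noteq> 0" by (metis det_I det_mul mult_zero_left zero_neq_one)
    then have "invertible g" by (simp add: invertible_det_nz det_emb flip: g)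
    then have "g \<in> torus" using emb_D_commuting[OF g] eig_eqI[OF g] y(3) by (simp add: torus_def)
    \<comment> \<open>The power 0, the identity, is included because the moment argument needs every
      exponent.\<close>
    then have "matrix_pow g r \<in> torus" for r
      by (induction r) (simp_all add: matrix_pow_Suc mat_1_torus mult_torus)
    then have "F (D (\<lambda>k. y k ^ r)) = 0" for r
      using F0[of "matrix_pow g r"] by (simp add: emb_matrix_pow g matrix_pow_D)
    then have "(\<Sum>i<N. c i * (\<Prod>k\<in>UNIV. y k ^ m i k) ^ r) = 0" for r
      by (simp add: cm prod_power_distrib mult.commute flip: power_mult)
    then have "(\<Sum>i<N. c i * (\<Sum>k\<in>UNIV. of_nat (m i k) * eig A k)) = 0"
    proof (rule power_moments_vanish[rotated])
      fix i j assume "i \<in> {..<N}" "j \<in> {..<N}" "(\<Prod>k\<in>UNIV. y k ^ m i k) = (\<Prod>k\<in>UNIV. y k ^ m j k)"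
      then show "(\<Sum>k\<in>UNIV. of_nat (m i k) * eig A k) = (\<Sum>k\<in>UNIV. of_nat (m j k) * eig A k)"
        by (intro hull_exponents[OF A] y(4)) auto
    qed simp
    then show "has_dir_deriv F (mat 1) (emb A) 0"
      using has_dir_deriv_torus[OF cm, of "\<lambda>_. 1" "eig A"] by (simp add: embA D_1)
  qed
qed

text \<open>Differentiating the defining equations at the identity gives the linear ones: the
  commutator is already linear, and a multiplicative relation becomes the additive relation with the
  same integers.\<close>

lemma Lie_of_torus_subset_hull: "Lie_of torus \<subseteq> alg_hull"
proof
  fix A assume A: "A \<in> Lie_of torus"
  have "(emb A ** emb X - emb X ** emb A :: 'k^'n^'n) $ i $ j = 0" for i j
  proof -
    let ?F = "\<lambda>B::'k^'n^'n. (B ** emb X - emb X ** B) $ i $ j"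
    have 1: "has_dir_deriv ?F (mat 1) (emb A) 0"
      by (rule Lie_of_emb[OF A matpolyfun_commutator]) (simp add: torus_def flip: emb_mult)
    have "?F (mat 1 + matrix_scale s (emb A)) = poly [:0, ?F (emb A):] s" for s
      by (simp add: matrix_scale_def matrix_matrix_mult_def mat_def sum.distrib sum_distrib_left
          sum_subtractf algebra_simps if_distrib[of "\<lambda>x. _ * x"] if_distrib[of "\<lambda>x. x * _"]
          sum.delta cong: if_cong)
    then have "has_dir_deriv ?F (mat 1) (emb A) (?F (emb A))"
      unfolding has_dir_deriv_def by (intro exI[of _ "[:0, ?F (emb A):]"]) simp
    with 1 show ?thesis using has_dir_deriv_unique by blast
  qed
  then have "(emb (A ** X) :: 'k^'n^'n) = emb (X ** A)"
    by (simp add: emb_mult vec_eq_iff)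
  then have comm: "A ** X = X ** A" by simp
  have embA: "emb A = D (eig A)" by (rule emb_commuting[OF comm])
  have "(\<Sum>k\<in>UNIV. of_int (e k) * eig A k) = 0" if e: "lin_rel e" for e
  proof -
    have 1: "has_dir_deriv (rel_poly e) (mat 1) (emb A) 0"
      by (rule Lie_of_emb[OF A matpolyfun_rel_poly]) (use e in \<open>simp add: torus_def rel_poly_def eig_def\<close>)
    \<comment> \<open>The two monomials of \<open>rel_poly\<close>, with signs, in the indexed form
      expected by \<open>has_dir_deriv_torus\<close>.\<close>
    define c :: "nat \<Rightarrow> 'k" where "c i = (if i = 0 then 1 else - 1)" for i
    define m :: "nat \<Rightarrow> 'n \<Rightarrow> nat" where "m i k = (if i = 0 then nat (e k) else nat (- e k))" for i k
    have "rel_poly e (D z) = (\<Sum>i<2. c i * (\<Prod>k\<in>UNIV. z k ^ m i k))" for z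
      by (simp add: rel_poly_def QDP diag_mat_def c_def m_def numeral_2_eq_2)
    from has_dir_deriv_torus[OF this, of "\<lambda>_. 1" "eig A"]
    have "has_dir_deriv (rel_poly e) (mat 1) (emb A) (\<Sum>i<2. c i * (\<Sum>k\<in>UNIV. of_nat (m i k) * eig A k))"
      by (simp add: D_1 embA)
    with 1 have "0 = (\<Sum>i<2. c i * (\<Sum>k\<in>UNIV. of_nat (m i k) * eig A k))"
      using has_dir_deriv_unique by blast
    also have "\<dots> = (\<Sum>k\<in>UNIV. (of_nat (nat (e k)) - of_nat (nat (- e k))) * eig A k)"
      by (simp add: c_def m_def numeral_2_eq_2 sum_subtractf left_diff_distrib)
    also have "\<dots> = (\<Sum>k\<in>UNIV. of_int (e k) * eig A k)"
    proof -
      have "of_nat (nat i) - of_nat (nat (- i)) = (of_int i :: 'k)" for i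
        by (cases "i \<ge> 0") auto
      then show ?thesis by simp
    qed
    finally show ?thesis by simp
  qed
  with comm show "A \<in> alg_hull" by (simp add: alg_hull_def)
qed

lemma hull_eq_Lie_of_torus: "alg_hull = Lie_of torus"
  using hull_subset_Lie_of_torus Lie_of_torus_subset_hull by blast

section \<open>Minimality among the algebraic Lie algebras containing X\<close>

lemma hull_subset_Lie_of:
  assumes G: "algebraic_subgroup G" and X: "X \<in> Lie_of G"
  shows "alg_hull \<subseteq> Lie_of G"
proof
  fix A assume A: "A \<in> alg_hull"
  then have embA: "emb A = D (eig A)" by (simp add: alg_hull_def emb_commuting)
  show "A \<in> Lie_of G"
  proof (rule Lie_of_subsetI)
    fix F :: "'k^'n^'n \<Rightarrow> 'k" assume F: "matpolyfun F" and F0: "\<And>g. g \<in> G \<Longrightarrow> F (emb g) = 0"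
    obtain N :: nat and c m where cm: "\<And>z. F (D z) = (\<Sum>i<N. c i * (\<Prod>k\<in>UNIV. z k ^ m i k))"
      using polynomial_on_torus[OF F] by blast
    define x where "x i = (\<Sum>k\<in>UNIV. of_nat (m i k) * \<alpha> k)" for i
    \<comment> \<open>The ideal of \<open>G\<close> is stable under the left-invariant derivation given by \<open>X\<close>.\<close>
    have "\<exists>H. matpolyfun H \<and> (\<forall>g\<in>G. H (emb g) = 0) \<and>
        (\<forall>z. H (D z) = (\<Sum>i<N. (c i * x i ^ r) * (\<Prod>k\<in>UNIV. z k ^ m i k)))" for r
    proof (induction r)
      case 0
      show ?case using F F0 cm by (intro exI[of _ F]) simp
    next
      case (Suc r)
      then obtain H where H: "matpolyfun H" "\<And>g. g \<in> G \<Longrightarrow> H (emb g) = 0"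
        "\<And>z. H (D z) = (\<Sum>i<N. (c i * x i ^ r) * (\<Prod>k\<in>UNIV. z k ^ m i k))" by blast
      obtain D' where D': "\<And>g B. has_dir_deriv H g B (D' g B)" "matpolyfun (\<lambda>g. D' g (g ** emb X))"
        using matpolyfun_has_dir_deriv[OF H(1), of "emb X"] by blast
      have "D' (emb g) (emb g ** emb X) = 0" if g: "g \<in> G" for g
      proof -
        \<comment> \<open>The left translate by \<open>g\<close> again vanishes on \<open>G\<close>,
          so the tangent condition for \<open>X\<close> at the identity applies to it and yields the
          one at \<open>g\<close>.\<close>
        let ?H = "\<lambda>h. H (emb g ** h)"
        have "has_dir_deriv ?H (mat 1) (emb X) 0"
        proof (rule Lie_of_emb[OF X matpolyfun_left_translate[OF H(1)]])
          fix h assume "h \<in> G"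
          then have "g ** h \<in> G" using G g by (simp add: algebraic_subgroup_def)
          then show "H (emb g ** emb h) = 0" using H(2) by (simp flip: emb_mult)
        qed
        moreover have "emb g ** (mat 1 + matrix_scale s (emb X)) = emb g + matrix_scale s (emb g ** emb X)" for s :: 'k
        proof -
          have "emb g ** matrix_scale s (emb X) = matrix_scale s (emb g ** emb X)"
            by (simp add: matrix_matrix_mult_def matrix_scale_def vec_eq_iff sum_distrib_left ac_simps)
          then show ?thesis by (simp add: matrix_add_ldistrib)
        qed
        ultimately have "has_dir_deriv H (emb g) (emb g ** emb X) 0"
          by (simp add: has_dir_deriv_def)
        then show ?thesis using D'(1) has_dir_deriv_unique by blast
      qed
      \<comment> \<open>On the diagonal algebra one derivation multiplies the i-th monomial by its
        eigenvalue \<open>x i\<close>.\<close>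
      moreover have "D' (D z) (D z ** emb X) = (\<Sum>i<N. (c i * x i ^ Suc r) * (\<Prod>k\<in>UNIV. z k ^ m i k))" for z
      proof (rule has_dir_deriv_unique[OF D'(1)])
        show "has_dir_deriv H (D z) (D z ** emb X) (\<Sum>i<N. (c i * x i ^ Suc r) * (\<Prod>k\<in>UNIV. z k ^ m i k))"
          using has_dir_deriv_torus[OF H(3), of z \<alpha>] by (simp add: emb_X D_mult x_def mult.assoc mult.commute[of _ "x _ ^ r"] power_commutes)
      qed
      ultimately show ?case using D'(2) by (intro exI[of _ "\<lambda>g. D' g (g ** emb X)"]) blast
    qed
    then have "(\<Sum>i<N. c i * x i ^ r) = 0" for r
    proof -
      obtain H where H: "\<And>g. g \<in> G \<Longrightarrow> H (emb g) = (0::'k)"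
        "\<And>z. H (D z) = (\<Sum>i<N. (c i * x i ^ r) * (\<Prod>k\<in>UNIV. z k ^ m i k))"
        using \<open>\<exists>H. matpolyfun H \<and> (\<forall>g\<in>G. H (emb g) = 0) \<and>
        (\<forall>z. H (D z) = (\<Sum>i<N. (c i * x i ^ r) * (\<Prod>k\<in>UNIV. z k ^ m i k)))\<close> by blast
      \<comment> \<open>At the identity all monomials are 1, which leaves the bare moments.\<close>
      have "mat 1 \<in> G" using G by (simp add: algebraic_subgroup_def)
      then show ?thesis using H(1)[of "mat 1"] H(2)[of "\<lambda>_. 1"] by (simp add: D_1)
    qed
    then have "(\<Sum>i<N. c i * (\<Sum>k\<in>UNIV. of_nat (m i k) * eig A k)) = 0"
    proof (rule power_moments_vanish[rotated])
      fix i j assume "x i = x j"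
      then have "lin_rel (\<lambda>k. int (m i k) - int (m j k))"
        by (simp add: lin_rel_def x_def left_diff_distrib sum_subtractf)
      then show "(\<Sum>k\<in>UNIV. of_nat (m i k) * eig A k) = (\<Sum>k\<in>UNIV. of_nat (m j k) * eig A k)"
        by (rule hull_exponents[OF A])
    qed simp
    then show "has_dir_deriv F (mat 1) (emb A) 0"
      using has_dir_deriv_torus[OF cm, of "\<lambda>_. 1" "eig A"] by (simp add: embA D_1)
  qed
qed


lemma subspace_hull: "matrix_space.subspace alg_hull"
proof -
  have emb0: "emb 0 = D (\<lambda>_. 0)" by (simp add: D_0)
  have 0: "0 \<in> alg_hull"
    using emb_D_commuting[OF emb0] eig_eqI[OF emb0] by (simp add: alg_hull_def)
  have lin: "A + matrix_scale c B \<in> alg_hull" if AB: "A \<in> alg_hull" "B \<in> alg_hull" for A B c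
  proof -
    have "emb A = D (eig A)" "emb B = D (eig B)" using AB by (auto simp: alg_hull_def emb_commuting)
    then have e: "emb (A + matrix_scale c B) = D (\<lambda>k. eig A k + of_rat c * eig B k)"
      by (simp add: emb_add emb_matrix_scale D_add_scale)
    have "(\<Sum>k\<in>UNIV. of_int (e k) * (eig A k + of_rat c * eig B k)) =
        (\<Sum>k\<in>UNIV. of_int (e k) * eig A k) + of_rat c * (\<Sum>k\<in>UNIV. of_int (e k) * eig B k)" for e
      by (simp add: distrib_left sum.distrib sum_distrib_left ac_simps)
    then show ?thesis
      using AB emb_D_commuting[OF e] unfolding alg_hull_def eig_eqI[OF e] by (simp add: eig_eqI[OF e])
  qed
  show ?thesis
  proof (rule matrix_space.subspaceI)
    show "A + B \<in> alg_hull" if "A \<in> alg_hull" "B \<in> alg_hull" for A B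
      using lin[OF that, of 1] by (simp add: matrix_space.scale_one)
    show "matrix_scale c A \<in> alg_hull" if "A \<in> alg_hull" for c A
      using lin[OF 0 that, of c] by simp
  qed (rule 0)
qed

lemma X_in_hull: "X \<in> alg_hull"
  using eig_eqI[OF emb_X] by (simp add: alg_hull_def lin_rel_def)

lemma algebraic_lie_algebra_hull: "algebraic_lie_algebra alg_hull"
proof -
  have "A ** B = B ** A" if "A \<in> alg_hull" "B \<in> alg_hull" for A B
  proof -
    have "emb A = D (eig A)" "emb B = D (eig B)" using that by (auto simp: alg_hull_def emb_commuting)
    then have "(emb (A ** B) :: 'k^'n^'n) = emb (B ** A)" by (simp add: emb_mult D_mult mult.commute)
    then show ?thesis by simp
  qed
  then have "lie_subalgebra alg_hull"
    using subspace_hull matrix_space.subspace_0[OF subspace_hull] by (simp add: lie_subalgebra_def)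
  then show ?thesis
    using algebraic_subgroup_torus hull_eq_Lie_of_torus by (auto simp: algebraic_lie_algebra_def)
qed

text \<open>The least element is exhibited, so its existence is obtained here without appeal to
  Chevalley's theorem.\<close>

theorem algebraic_hull_of_matrix_eq: "algebraic_hull_of_matrix X = alg_hull"
  unfolding algebraic_hull_of_matrix_def algebraic_hull_def
proof (rule Least_equality)
  show "algebraic_lie_algebra alg_hull \<and> matrix_space.span {X} \<subseteq> alg_hull"
    using algebraic_lie_algebra_hull X_in_hull subspace_hull
    by (simp add: matrix_space.span_minimal)
next
  fix H assume "algebraic_lie_algebra H \<and> matrix_space.span {X} \<subseteq> H"
  then show "alg_hull \<subseteq> H"
    using hull_subset_Lie_of matrix_space.span_base[of X "{X}"]
    by (auto simp: algebraic_lie_algebra_def)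
qed

end

section \<open>Diagonalisation over the splitting field\<close>

abbreviation rpoly :: "rat poly \<Rightarrow> 'k::field_char_0 \<Rightarrow> 'k" where
  "rpoly p a \<equiv> poly (map_poly of_rat p) a"

lemma rpoly_altdef: "rpoly p a = (\<Sum>i\<le>degree p. of_rat (coeff p i) * a ^ i)"
  by (simp add: poly_altdef coeff_map_poly degree_map_poly)

lemma rpoly_pCons: "rpoly (pCons c p) a = of_rat c + a * rpoly p a"
  by (simp add: map_poly_pCons)

lemma rpoly_add: "rpoly (p + q) a = rpoly p a + rpoly q a"
proof -
  have "map_poly of_rat (p + q) = map_poly of_rat p + (map_poly of_rat q :: 'a poly)"
    by (intro poly_eqI) (simp add: coeff_map_poly of_rat_add)
  then show ?thesis by simp
qed

lemma rpoly_diff: "rpoly (p - q) a = rpoly p a - rpoly q a"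
  using rpoly_add[of "p - q" q a] by simp

lemma rpoly_smult: "rpoly (smult c p) a = of_rat c * rpoly p a"
proof -
  have "map_poly of_rat (smult c p) = smult (of_rat c) (map_poly of_rat p :: 'a poly)"
    by (intro poly_eqI) (simp add: coeff_map_poly of_rat_mult)
  then show ?thesis by simp
qed

lemma rpoly_mult: "rpoly (p * q) a = rpoly p a * rpoly q a"
  by (induction p) (simp_all add: rpoly_pCons rpoly_add rpoly_smult algebra_simps)

lemma rpoly_sum: "rpoly (\<Sum>i\<in>A. f i) a = (\<Sum>i\<in>A. rpoly (f i) a)"
  by (induction A rule: infinite_finite_induct) (simp_all add: rpoly_add)

lemma rpoly_1: "rpoly 1 a = 1"
  using rpoly_pCons[of 1 0 a] by (simp add: one_pCons)

lemma rpoly_prod: "rpoly (\<Prod>i\<in>A. f i) a = (\<Prod>i\<in>A. rpoly (f i) a)"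
  by (induction A rule: infinite_finite_induct) (simp_all add: rpoly_mult rpoly_1)

lemma rpoly_of_int: "rpoly (of_int i) a = of_int i"
  by (simp add: of_int_poly map_poly_pCons)

lemma rpoly_pderiv: "rpoly (pderiv p) a = poly (pderiv (map_poly of_rat p)) a"
proof -
  have "map_poly of_rat (pderiv p) = pderiv (map_poly of_rat p :: 'a poly)"
    by (intro poly_eqI) (simp add: coeff_map_poly coeff_pderiv of_rat_mult of_rat_add del: of_nat_Suc)
  then show ?thesis by simp
qed

lemma rpoly_charpoly:
  fixes X :: "rat^'n^'n" and a :: "'k::field_char_0"
  shows "rpoly (matrix_charpoly X) a = det (mat a - emb X)"
proof -
  have "rpoly ((mat [:0, 1:] - (\<chi> i j. [:X $ i $ j:])) $ i $ j) a = (mat a - emb X) $ i $ j" for i j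
    by (simp add: mat_def emb_def rpoly_diff rpoly_pCons del: diff_pCons diff_0)
  then show ?thesis
    by (simp only: matrix_charpoly_def det_def rpoly_sum rpoly_mult rpoly_prod rpoly_of_int)
qed

text \<open>A repeated root \<open>a\<close> would make the square of the minimal polynomial of \<open>a\<close> a divisor.\<close>

lemma squarefree_no_double_root:
  fixes p :: "rat poly" and a :: "'k::field_char_0"
  assumes "squarefree p" "rpoly p a = 0" "rpoly (pderiv p) a = 0"
  shows False
proof -
  have "p \<noteq> 0" using assms(1) by auto
  define S where "S = {m :: rat poly. m \<noteq> 0 \<and> rpoly m a = 0}"
  \<comment> \<open>Up to a scalar this is the minimal polynomial of \<open>a\<close> over the
    rationals; division with remainder makes it divide every rational polynomial vanishing at
    \<open>a\<close>.\<close>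
  define m where "m = (ARG_MIN degree m. m \<in> S)"
  have m: "m \<in> S" and min: "\<And>q. q \<in> S \<Longrightarrow> degree m \<le> degree q"
    unfolding m_def using arg_min_nat_lemma[of "\<lambda>m. m \<in> S" p degree] \<open>p \<noteq> 0\<close> assms(2)
    by (auto simp: S_def)
  have dvd: "m dvd q" if "rpoly q a = 0" for q
  proof -
    have "rpoly (m * (q div m) + q mod m) a = 0" using that by simp
    then have "rpoly (q mod m) a = 0" using m by (simp only: rpoly_add rpoly_mult) (simp add: S_def)
    moreover have "q mod m = 0 \<or> degree (q mod m) < degree m"
      by (rule degree_mod_less) (use m in \<open>simp add: S_def\<close>)
    ultimately have "q mod m = 0" using min[of "q mod m"] by (force simp: S_def)
    then show ?thesis by (simp add: mod_eq_0_iff_dvd)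
  qed
  obtain q where q: "p = m * q" using dvd[OF assms(2)] by (elim dvdE)
  have "degree m \<noteq> 0"
  proof
    assume "degree m = 0"
    then obtain c where "m = [:c:]" by (rule degree_eq_zeroE)
    then show False using m by (simp add: S_def rpoly_pCons)
  qed
  \<comment> \<open>Characteristic 0 keeps the derivative nonzero, and its smaller degree prevents
    it from vanishing at \<open>a\<close>.\<close>
  then have "pderiv m \<noteq> 0" "degree (pderiv m) < degree m"
    by (auto simp: pderiv_eq_0_iff degree_pderiv)
  then have "rpoly (pderiv m) a \<noteq> 0" using min[of "pderiv m"] by (auto simp: S_def)
  moreover have "rpoly (pderiv m) a * rpoly q a = 0"
    using assms(3) m by (auto simp: q pderiv_mult rpoly_add rpoly_mult S_def)
  ultimately have "m dvd q" using dvd by simp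
  then have "m\<^sup>2 dvd p" by (simp add: q power2_eq_square mult_dvd_mono)
  then have "m dvd 1" using assms(1) by (rule squarefreeD[rotated])
  then show False using \<open>degree m \<noteq> 0\<close> m by (auto simp: S_def is_unit_iff_degree)
qed

lemma squarefree_imp_distinct_roots:
  fixes \<alpha> :: "'k::field_char_0^'n" and p :: "rat poly"
  assumes "squarefree p" and p: "map_poly of_rat p = (\<Prod>k\<in>UNIV. [:- (\<alpha> $ k), 1:])"
  shows "inj (($) \<alpha>)"
proof (rule injI, rule ccontr)
  fix j k assume jk: "\<alpha> $ j = \<alpha> $ k" "j \<noteq> k"
  define s where "s = (\<Prod>i\<in>UNIV - {j} - {k}. [:- (\<alpha> $ i), 1:])"
  have fact: "map_poly of_rat p = [:- (\<alpha> $ j), 1:] * ([:- (\<alpha> $ k), 1:] * s)"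
    unfolding p s_def using jk by (simp add: prod.remove[of UNIV j] prod.remove[of "UNIV - {j}" k])
  have double_root: "poly (q * (r * s)) a = 0 \<and> poly (pderiv (q * (r * s))) a = 0"
    if "poly q a = 0" "poly r a = 0" for q r s :: "'k poly" and a
    using that by (simp add: pderiv_mult)
  have "rpoly p (\<alpha> $ j) = 0 \<and> rpoly (pderiv p) (\<alpha> $ j) = 0"
    unfolding rpoly_pderiv fact by (rule double_root) (simp_all add: jk(1))
  then show False using squarefree_no_double_root[OF assms(1)] by blast
qed

lemma eigenvector_exists:
  fixes A :: "'k::field^'n^'n"
  assumes "det (mat a - A) = 0"
  shows "\<exists>v. v \<noteq> 0 \<and> A *v v = a *s v"
proof -
  have "\<not> invertible (mat a - A)" using assms by (simp add: invertible_det_nz)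
  then obtain v where v: "v \<noteq> 0" "(mat a - A) *v v = 0"
    using matrix_left_invertible_ker[of "mat a - A"] by (auto simp: invertible_left_inverse)
  have "mat a *v v = a *s v"
    by (simp add: mat_def matrix_vector_mult_def vec_eq_iff if_distrib[of "\<lambda>x. x * _"] sum.delta cong: if_cong)
  then show ?thesis using v by (auto simp: matrix_vector_mult_diff_rdistrib)
qed

text \<open>Eigenvectors form the columns of \<open>P\<close>. Applying powers of \<open>A\<close>
  to a linear relation between them gives vanishing moments at the distinct eigenvalues, so the
  relation is trivial and \<open>P\<close> is invertible.\<close>

lemma diagonalisation_exists:
  fixes A :: "'k::field^'n^'n" and \<alpha> :: "'n \<Rightarrow> 'k"
  assumes inj: "inj \<alpha>" and det: "\<And>k. det (mat (\<alpha> k) - A) = 0"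
  shows "\<exists>P Q. P ** Q = mat 1 \<and> Q ** P = mat 1 \<and> A = P ** diag_mat \<alpha> ** Q"
proof -
  obtain v where v: "\<And>k. v k \<noteq> 0" "\<And>k. A *v v k = \<alpha> k *s v k"
    using eigenvector_exists[OF det] by metis
  define P where "P = (\<chi> i k. v k $ i)"
  have AP: "A ** P = P ** diag_mat \<alpha>"
  proof -
    have "(A ** P) $ i $ k = (A *v v k) $ i" for i k
      by (simp add: P_def matrix_matrix_mult_def matrix_vector_mult_def)
    moreover have "(P ** diag_mat \<alpha>) $ i $ k = (\<alpha> k *s v k) $ i" for i k
      by (simp add: P_def matrix_matrix_mult_def diag_mat_def if_distrib[of "\<lambda>x. _ * x"] sum.delta
          mult.commute cong: if_cong)
    ultimately show ?thesis by (simp add: vec_eq_iff v(2))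
  qed
  have "c = 0" if c: "P *v c = 0" for c
  proof -
    have "(\<Sum>k\<in>UNIV. (c $ k * v k $ i) * \<alpha> k ^ r) = 0" for i r
    proof -
      have "(\<Sum>k\<in>UNIV. (c $ k * \<alpha> k ^ r) *s v k) = 0"
      proof (induction r)
        case 0
        show ?case using c by (simp add: P_def matrix_vector_mult_def vec_eq_iff mult.commute)
      next
        case (Suc r)
        have "0 = A *v (\<Sum>k\<in>UNIV. (c $ k * \<alpha> k ^ r) *s v k)" using Suc by simp
        also have "\<dots> = (\<Sum>k\<in>UNIV. (c $ k * \<alpha> k ^ Suc r) *s v k)"
          by (simp add: vec.linear_sum[OF matrix_vector_mul_linear_gen] matrix_vector_mult_scaleR
              vec.scale_left_commute vec.linear_scale[OF matrix_vector_mul_linear_gen] v(2) mult.assoc mult.commute[of "\<alpha> _"])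
        finally show ?case by simp
      qed
      then have "(\<Sum>k\<in>UNIV. (c $ k * \<alpha> k ^ r) *s v k) $ i = 0" by simp
      then show ?thesis by (simp add: ac_simps)
    qed
    then have "(\<Sum>k\<in>UNIV. (c $ k * v k $ i) * (if k = j then 1 else 0)) = 0" for i j
      by (rule power_moments_vanish[OF finite]) (use inj in \<open>auto simp: inj_eq\<close>)
    then have "c $ j * v j $ i = 0" for i j
      by (simp add: if_distrib[of "\<lambda>x. _ * x"] sum.delta cong: if_cong)
    then show "c = 0" using v(1) by (simp add: vec_eq_iff) metis
  qed
  then obtain Q where Q: "Q ** P = mat 1"
    using matrix_left_invertible_ker[of P] by auto
  then have PQ: "P ** Q = mat 1" by (simp add: matrix_left_right_inverse)
  have "A = A ** P ** Q" by (simp add: PQ flip: matrix_mul_assoc)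
  then show ?thesis using Q PQ AP by metis
qed

section \<open>Coordinates with respect to powers of the matrix\<close>

lemma basis_family_image:
  assumes hom: "module_hom s1 s2 T" and "basis_family s1 I b V" and inj: "inj_on T V"
  shows "basis_family s2 I (\<lambda>i. T (b i)) (T ` V)"
proof -
  interpret module_hom s1 s2 T by (rule hom)
  have b: "inj_on b I" "m1.independent (b ` I)" "m1.span (b ` I) = V"
    using assms(2) by (auto simp: basis_family_def)
  have "inj_on (\<lambda>i. T (b i)) I"
    using comp_inj_on[OF b(1), of T] inj_on_subset[OF inj, of "b ` I"] m1.span_superset[of "b ` I"] b(3)
    by (simp add: comp_def)
  moreover have "m2.independent (T ` b ` I)"
    using independent_injective_image[OF b(2)] inj b(3) by simp
  moreover have "m2.span (T ` b ` I) = T ` V" by (simp add: span_image b(3))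
  ultimately show ?thesis by (simp add: basis_family_def image_image)
qed

text \<open>Exchanging sums turns the dependency on the \<open>Delta\<close> values into the
  relation \<open>f\<close> applied to the numbers q(\<alpha>_k), where q has coefficients
  \<open>u\<close>; these will be the eigenvalues of q(X).\<close>

lemma Upsilon_eq:
  fixes \<alpha> :: "'k::field_char_0^'n"
  assumes "basis_family (*s) {1..l} e (eigenvalue_relations \<alpha>)"
  shows "Upsilon \<alpha> t l e = {u \<in> rat_tuples t. \<forall>f\<in>eigenvalue_relations \<alpha>.
     (\<Sum>k\<in>UNIV. of_int (f $ k) * (\<Sum>i\<le>t. of_rat (u i) * \<alpha> $ k ^ i)) = 0}"
proof -
  have eq: "(\<Sum>i\<le>t. of_rat (u i) * Delta \<alpha> i f) =
      (\<Sum>k\<in>UNIV. of_int (f $ k) * (\<Sum>i\<le>t. of_rat (u i) * \<alpha> $ k ^ i))" for u f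
    unfolding Delta_def sum_distrib_left by (subst sum.swap) (simp add: ac_simps)
  have span: "module.span (*s) (e ` {1..l}) = eigenvalue_relations \<alpha>"
    using assms by (simp add: basis_family_def)
  interpret M: module "(*s) :: int \<Rightarrow> int^'n \<Rightarrow> int^'n" by (rule module_vec_scale)
  have *: "(\<forall>j\<in>{1..l}. (\<Sum>k\<in>UNIV. of_int (e j $ k) * w k) = 0) \<longleftrightarrow>
      (\<forall>f\<in>eigenvalue_relations \<alpha>. (\<Sum>k\<in>UNIV. of_int (f $ k) * w k) = 0)" for w :: "'n \<Rightarrow> 'k"
  proof
    assume e: "\<forall>j\<in>{1..l}. (\<Sum>k\<in>UNIV. of_int (e j $ k) * w k) = 0"
    \<comment> \<open>The integral relations satisfied by \<open>w\<close> form a submodule, so it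
      is enough to check generators of the lattice.\<close>
    have "M.subspace {f. (\<Sum>k\<in>UNIV. of_int (f $ k) * w k) = 0}"
      by (rule M.subspaceI)
        (simp_all add: distrib_right sum.distrib mult.assoc flip: sum_distrib_left)
    then have "M.span (e ` {1..l}) \<subseteq> {f. (\<Sum>k\<in>UNIV. of_int (f $ k) * w k) = 0}"
      using e by (intro M.span_minimal) auto
    then show "\<forall>f\<in>eigenvalue_relations \<alpha>. (\<Sum>k\<in>UNIV. of_int (f $ k) * w k) = 0"
      unfolding span by auto
  next
    assume "\<forall>f\<in>eigenvalue_relations \<alpha>. (\<Sum>k\<in>UNIV. of_int (f $ k) * w k) = 0"
    then show "\<forall>j\<in>{1..l}. (\<Sum>k\<in>UNIV. of_int (e j $ k) * w k) = 0"
      using M.span_superset[of "e ` {1..l}"] unfolding span by auto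
  qed
  show ?thesis
    using *[of "\<lambda>k. \<Sum>i\<le>t. of_rat (u i) * \<alpha> $ k ^ i" for u]
    by (auto simp: Upsilon_def Delta_dependencies_def eq)
qed

context diagonalised_matrix
begin

lemma emb_matrix_poly: "emb (matrix_poly q X) = D (\<lambda>k. rpoly q (\<alpha> k))"
  by (simp add: matrix_poly_def emb_sum emb_matrix_scale emb_matrix_pow emb_X matrix_pow_D
      rpoly_altdef D_sum D_scale)

lemma matrix_poly_eq_0_iff: "matrix_poly q X = 0 \<longleftrightarrow> (\<forall>k. rpoly q (\<alpha> k) = 0)"
proof -
  have "matrix_poly q X = 0 \<longleftrightarrow> D (\<lambda>k. rpoly q (\<alpha> k)) = D (\<lambda>_. 0)"
    by (metis emb_matrix_poly emb_eq_iff D_0 emb_0)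
  then show ?thesis by (auto simp: D_eq_iff fun_eq_iff)
qed

lemma vanishing_low_degree:
  assumes "\<And>k. rpoly q (\<alpha> k) = 0" "degree q < CARD('n)"
  shows "q = 0"
proof (rule ccontr)
  let ?q = "map_poly of_rat q :: 'k poly"
  assume "q \<noteq> 0"
  then have "?q \<noteq> 0" by (auto simp: poly_eq_iff coeff_map_poly)
  then have "card {x. poly ?q x = 0} \<le> degree ?q" by (rule card_poly_roots_bound)
  also have "degree ?q \<le> degree q" by (rule map_poly_degree_leq)
  also have "\<dots> < card (range \<alpha>)" using assms(2) by (simp add: card_image inj_\<alpha>)
  also have "\<dots> \<le> card {x. poly ?q x = 0}"
    using \<open>?q \<noteq> 0\<close> by (intro card_mono poly_roots_finite) (auto simp: assms(1))
  finally show False by simp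
qed

text \<open>Annihilating X means vanishing at all the roots, which are distinct and as many as the
  degree of \<open>p\<close>; hence remainders modulo \<open>p\<close> are zero.\<close>

lemma matrix_minpoly_eq:
  assumes p: "map_poly of_rat p = (\<Prod>k\<in>UNIV. [:- \<alpha> k, 1:])"
  shows "matrix_minpoly X = p" "degree p = CARD('n)"
proof -
  have deg: "degree (map_poly of_rat p :: 'k poly) = CARD('n)"
    unfolding p by (subst degree_prod_eq_sum_degree) auto
  moreover have "degree (map_poly of_rat p :: 'k poly) = degree p"
    by (rule degree_map_poly) simp
  ultimately show degp: "degree p = CARD('n)" by simp
  have "lead_coeff (map_poly of_rat p :: 'k poly) = 1"
    unfolding p by (simp add: lead_coeff_prod)
  then have lead: "lead_coeff p = 1"
    using deg degp by (simp add: coeff_map_poly)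
  have root: "rpoly p (\<alpha> k) = 0" for k
    unfolding p by (auto simp: poly_prod)
  have dvd: "p dvd q" if "matrix_poly q X = 0" for q
  proof -
    have "rpoly (p * (q div p) + q mod p) (\<alpha> k) = 0" for k
      using that by (simp add: matrix_poly_eq_0_iff)
    then have "rpoly (q mod p) (\<alpha> k) = 0" for k
      by (simp only: rpoly_add rpoly_mult root) simp
    moreover have "q mod p = 0 \<or> degree (q mod p) < degree p"
      by (rule degree_mod_less) (use lead in auto)
    ultimately have "q mod p = 0" using vanishing_low_degree[of "q mod p"] degp by auto
    then show ?thesis by (simp add: mod_eq_0_iff_dvd)
  qed
  show "matrix_minpoly X = p"
    unfolding matrix_minpoly_def
  proof (rule the_equality)
    show "lead_coeff p = 1 \<and> matrix_poly p X = 0 \<and> (\<forall>q. matrix_poly q X = 0 \<longrightarrow> p dvd q)"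
      using lead root dvd by (simp add: matrix_poly_eq_0_iff)
  next
    fix r assume r: "lead_coeff r = 1 \<and> matrix_poly r X = 0 \<and> (\<forall>q. matrix_poly q X = 0 \<longrightarrow> r dvd q)"
    then have "p dvd r" "r dvd p"
      using dvd root by (auto simp: matrix_poly_eq_0_iff)
    moreover have "p \<noteq> 0" "r \<noteq> 0" using lead r by auto
    ultimately have "degree r = degree p" by (intro order.antisym dvd_imp_degree_le)
    obtain c where c: "r = p * c" using \<open>p dvd r\<close> by (elim dvdE)
    then have "degree c = 0"
      using \<open>degree r = degree p\<close> \<open>r \<noteq> 0\<close> by (auto simp: degree_mult_eq)
    then obtain a where "c = [:a:]" by (rule degree_eq_zeroE)
    moreover from this have "a = 1" using c r lead by (auto split: if_splits)
    ultimately show "r = p" using c by simp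
  qed
qed

lemma module_hom_matrix_of_coeffs: "module_hom seq_scale matrix_scale matrix_of_coeffs"
proof -
  have "matrix_of_coeffs (u + v) = matrix_of_coeffs u + matrix_of_coeffs v" for u v
    by (simp add: matrix_of_coeffs_def matrix_space.scale_left_distrib sum.distrib)
  moreover have "matrix_of_coeffs (seq_scale c u) = matrix_scale c (matrix_of_coeffs u)" for c u
    by (simp add: matrix_of_coeffs_def matrix_space.scale_sum_right seq_scale_def)
  ultimately show ?thesis
    by (simp add: module_hom_iff seq_space.module_axioms matrix_space.module_axioms)
qed

text \<open>Two coefficient vectors with the same matrix differ by a polynomial of degree below the
  number of roots that vanishes at all of them.\<close>

lemma inj_on_matrix_of_coeffs:
  assumes "t + 1 = CARD('n)"
  shows "inj_on matrix_of_coeffs (rat_tuples t)"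
proof (rule inj_onI)
  fix u v assume uv: "u \<in> rat_tuples t" "v \<in> rat_tuples t" "matrix_of_coeffs u = matrix_of_coeffs v"
  define q where "q = (\<Sum>i<CARD('n). monom (u i - v i) i)"
  have q: "coeff q i = (if i < CARD('n) then u i - v i else 0)" for i
    by (simp add: q_def coeff_sum coeff_monom)
  have eq: "(\<Sum>i<CARD('n). of_rat (u i) * \<alpha> k ^ i) = (\<Sum>i<CARD('n). of_rat (v i) * \<alpha> k ^ i)" for k
    using uv(3) emb_matrix_of_coeffs[of u] emb_matrix_of_coeffs[of v] by (simp add: D_eq_iff fun_eq_iff)
  have "rpoly q (\<alpha> k) = (\<Sum>i<CARD('n). (of_rat (u i) - of_rat (v i)) * \<alpha> k ^ i)" for k
  proof -
    have "rpoly (monom c i) (\<alpha> k) = of_rat c * \<alpha> k ^ i" for c i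
      by (simp add: map_poly_monom poly_monom)
    then show ?thesis by (simp add: q_def rpoly_sum of_rat_diff)
  qed
  then have "rpoly q (\<alpha> k) = 0" for k
    using eq[of k] by (simp add: left_diff_distrib sum_subtractf)
  moreover have "degree q < CARD('n)"
    by (rule degree_lessI) (simp_all add: q)
  ultimately have "q = 0" by (rule vanishing_low_degree)
  then have "u i = v i" if "i < CARD('n)" for i using q[of i] that by simp
  moreover have "u i = v i" if "\<not> i < CARD('n)" for i
    using uv(1,2) that assms by (simp add: rat_tuples_def)
  ultimately show "u = v" by (auto simp: fun_eq_iff)
qed

text \<open>The eigenvalues of q(X) are the q(\<alpha>_k), so the conditions defining the two sides
  agree; every element of the hull is reached because rational matrices commuting with X are
  polynomials in X.\<close>

lemma image_Upsilon:
  assumes t: "t + 1 = CARD('n)" and e: "basis_family (*s) {1..l} e (eigenvalue_relations (vec_lambda \<alpha>))"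
  shows "matrix_of_coeffs ` Upsilon (vec_lambda \<alpha>) t l e = alg_hull"
proof -
  have n: "{..<CARD('n)} = {..t}" using t by auto
  have eig: "eig (matrix_of_coeffs u) = (\<lambda>k. \<Sum>i\<le>t. of_rat (u i) * \<alpha> k ^ i)" for u
    using eig_eqI[OF emb_matrix_of_coeffs] by (simp add: n)
  have U: "Upsilon (vec_lambda \<alpha>) t l e = {u \<in> rat_tuples t. \<forall>f. lin_rel f \<longrightarrow>
      (\<Sum>k\<in>UNIV. of_int (f k) * (\<Sum>i\<le>t. of_rat (u i) * \<alpha> k ^ i)) = 0}"
  proof -
    have "f \<in> eigenvalue_relations (vec_lambda \<alpha>) \<longleftrightarrow> lin_rel (($) f)" for f :: "int^'n"
      by (simp add: eigenvalue_relations_def lin_rel_def)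
    then have "(\<forall>f\<in>eigenvalue_relations (vec_lambda \<alpha>). R (($) f)) \<longleftrightarrow> (\<forall>f. lin_rel f \<longrightarrow> R f)"
      for R :: "('n \<Rightarrow> int) \<Rightarrow> bool"
      by (metis vec_lambda_inverse UNIV_I)
    from this[of "\<lambda>f. (\<Sum>k\<in>UNIV. of_int (f k) * (\<Sum>i\<le>t. of_rat (u i) * \<alpha> k ^ i)) = 0" for u]
    show ?thesis by (simp add: Upsilon_eq[OF e])
  qed
  show ?thesis
  proof (intro equalityI subsetI)
    fix A assume "A \<in> matrix_of_coeffs ` Upsilon (vec_lambda \<alpha>) t l e"
    then show "A \<in> alg_hull"
      using emb_D_commuting[OF emb_matrix_of_coeffs] by (auto simp: U alg_hull_def eig)
  next
    fix A assume A: "A \<in> alg_hull"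
    then obtain u where u: "A = matrix_of_coeffs u"
      using commuting_imp_polynomial by (auto simp: alg_hull_def)
    \<comment> \<open>\<open>matrix_of_coeffs\<close> ignores entries beyond \<open>t\<close>, so
      they may be cut off to obtain a tuple.\<close>
    define v where "v i = (if i \<le> t then u i else 0)" for i
    have v: "A = matrix_of_coeffs v"
      by (simp add: u matrix_of_coeffs_def v_def n)
    have "v \<in> rat_tuples t" by (simp add: rat_tuples_def v_def)
    moreover have "eig A = (\<lambda>k. \<Sum>i\<le>t. of_rat (v i) * \<alpha> k ^ i)"
      unfolding v by (rule eig)
    ultimately have "v \<in> Upsilon (vec_lambda \<alpha>) t l e"
      using A by (simp add: U alg_hull_def)
    with v show "A \<in> matrix_of_coeffs ` Upsilon (vec_lambda \<alpha>) t l e" by blast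
  qed
qed

end

theorem mainTheorem3:
  fixes X :: "rat^'n^'n"
    and \<alpha> :: "'k::field_char_0^'n"
    and t l :: nat
    and e :: "nat \<Rightarrow> int^'n"
    and I :: "'i set"
    and u :: "'i \<Rightarrow> nat \<Rightarrow> rat"
  assumes "semisimple_matrix X"
    and "squarefree (matrix_charpoly X)"
    and "map_poly of_rat (matrix_charpoly X) = (\<Prod>k\<in>UNIV. [:- (\<alpha> $ k), 1:])"
    and "degree (matrix_minpoly X) = t + 1"
    and "basis_family (*s) {1..l} e (eigenvalue_relations \<alpha>)"
    and "basis_family seq_scale I u (Upsilon \<alpha> t l e)"
  shows "basis_family matrix_scale I (\<lambda>r. \<Sum>i\<le>t. matrix_scale (u r i) (matrix_pow X i))
           (algebraic_hull_of_matrix X)"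
proof -
  have inj: "inj (($) \<alpha>)"
    by (rule squarefree_imp_distinct_roots[OF assms(2,3)])
  have "rpoly (matrix_charpoly X) (\<alpha> $ k) = 0" for k
    unfolding assms(3) by (auto simp: poly_prod)
  then have "det (mat (\<alpha> $ k) - emb X) = 0" for k
    by (simp add: rpoly_charpoly)
  then obtain P Q :: "'k^'n^'n" where "P ** Q = mat 1" "Q ** P = mat 1" "emb X = P ** diag_mat (($) \<alpha>) ** Q"
    using diagonalisation_exists[OF inj] by blast
  then interpret diagonalised_matrix X "($) \<alpha>" P Q
    using inj by unfold_locales
  \<comment> \<open>The minimal polynomial is the whole characteristic polynomial, so the powers up
    to \<open>t\<close> are exactly those that occur in \<open>matrix_of_coeffs\<close>.\<close>
  have t: "t + 1 = CARD('n)"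
    using matrix_minpoly_eq[OF assms(3)] assms(4) by simp
  have \<alpha>: "vec_lambda (($) \<alpha>) = \<alpha>" by (simp add: vec_eq_iff)
  have "inj_on matrix_of_coeffs (Upsilon \<alpha> t l e)"
    using inj_on_matrix_of_coeffs[OF t] by (rule inj_on_subset) (auto simp: Upsilon_def)
  from basis_family_image[OF module_hom_matrix_of_coeffs assms(6) this]
  have "basis_family matrix_scale I (\<lambda>r. matrix_of_coeffs (u r)) (alg_hull)"
    using image_Upsilon[OF t, of l e] assms(5) by (simp add: \<alpha>)
  moreover have "{..<CARD('n)} = {..t}" using t by auto
  ultimately show ?thesis
    by (simp add: algebraic_hull_of_matrix_eq matrix_of_coeffs_def)
qed

end
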